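(* Let $\{q_k:k\geq 0\}$ be a non-decreasing sequence of nonnegative real numbers with $q_0>0$, let $Q_n:=\sum_{k=0}^{n-1}q_k$, and let $T_n^{\kappa}$ denote the associated $T$ means with respect to the Walsh-Kaczmarz system, with maximal operator $T^{\ast,\kappa}f:=\sup_{n\in\mathbb{N}}|T_n^{\kappa}f|$. (a) If moreover $$\frac{q_{n-1}}{Q_n}=O\!\left(\frac1n\right)\quad\text{as } n\to\infty,$$ then $T^{\ast,\kappa}$ is bounded from the martingale Hardy space $H_{1/2}$ to the space $L_{1/2,\infty}$, i.e. there is a constant $C$ with $\|T^{\ast,\kappa}f\|_{L_{1/2,\infty}}\le C\|f\|_{H_{1/2}}$ for all $f\in H_{1/2}$. (b) Let $0<p<1/2$. Then (for any such non-decreasing sequence, with no further condition) there exists a martingale $f\in H_p$ such that $$\sup_{n\in\mathbb{N}}\left\|T_n^{\kappa}f\right\|_{L_{p,\infty}}=\infty .$$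
   Context: Walsh group: $G=\prod_{k=0}^\infty \mathbb{Z}_2$, elements $x=(x_0,x_1,\dots)$ with $x_k\in\{0,1\}$, with coordinatewise addition mod 2 and the product probability measure $\mu$ (each point of $\mathbb{Z}_2$ has measure $1/2$). Rademacher functions: $r_k(x)=(-1)^{x_k}$. For $n\in\mathbb{N}$ write $n=\sum_{i\ge0}n_i2^i$ with $n_i\in\{0,1\}$, and for $n\ge1$ let $|n|:=\max\{j:n_j\neq0\}$. Walsh-Kaczmarz functions: $\kappa_0:=1$ and for $n\ge1$, $\kappa_n(x):=r_{|n|}(x)\,(-1)^{\sum_{k=0}^{|n|-1}n_kx_{|n|-1-k}}$. Dyadic intervals: $I_n(x)=\{y\in G: y_j=x_j,\ j<n\}$; $F_n$ is the $\sigma$-algebra generated by the dyadic intervals of measure $2^{-n}$. A martingale $f=(f^{(n)})_{n\in\mathbb{N}}$ is taken with respect to $(F_n)$; its maximal function is $f^\ast=\sup_n|f^{(n)}|$, and for $0<p<\infty$ the Hardy space $H_p$ consists of martingales with $\|f\|_{H_p}:=\|f^\ast\|_{L_p}<\infty$. Fourier coefficients of a martingale: $\widehat f(i)=\lim_{n\to\infty}\int_G f^{(n)}\kappa_i\,d\mu$. Partial sums: $S_0^{\kappa}f=0$, $S_M^{\kappa}f=\sum_{i=0}^{M-1}\widehat f(i)\kappa_i$. $T$ means: $T_n^{\kappa}f=\frac{1}{Q_n}\sum_{k=0}^{n-1}q_kS_k^{\kappa}f$. Weak space: $\|g\|_{L_{p,\infty}}^p:=\sup_{\lambda>0}\lambda^p\mu(|g|>\lambda)$.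 *)

theory Defs
  imports "HOL-Probability.Probability" "HOL-Library.Landau_Symbols"
begin

text \<open>Walsh group G = product of Z_2, points encoded as nat \<Rightarrow> bool
  (x k = True means x_k = 1), with the product of the uniform measures.\<close>

definition walsh_measure :: "(nat \<Rightarrow> bool) measure" where
  "walsh_measure = PiM UNIV (\<lambda>_. measure_pmf (bernoulli_pmf (1/2)))"

definition rademacher :: "nat \<Rightarrow> (nat \<Rightarrow> bool) \<Rightarrow> real" where
  "rademacher k x = (if x k then -1 else 1)"

definition lead :: "nat \<Rightarrow> nat" where
  "lead n = (GREATEST j. bit n j)"

definition kaczmarz :: "nat \<Rightarrow> (nat \<Rightarrow> bool) \<Rightarrow> real" where
  "kaczmarz n x = (if n = 0 then 1 else
     rademacher (lead n) x *
     (-1) ^ (\<Sum>k<lead n. (if bit n k \<and> x (lead n - 1 - k) then 1 else 0 :: nat)))"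

text \<open>Martingales w.r.t. the dyadic filtration (F_n): f n is F_n-measurable,
  i.e. depends only on x_0,...,x_(n-1), and E(f (n+1) | F_n) = f n, which for
  the product measure means averaging over the coordinate x_n.\<close>
definition walsh_martingale :: "(nat \<Rightarrow> (nat \<Rightarrow> bool) \<Rightarrow> real) \<Rightarrow> bool" where
  "walsh_martingale f \<longleftrightarrow>
     (\<forall>n x y. (\<forall>j<n. x j = y j) \<longrightarrow> f n x = f n y) \<and>
     (\<forall>n x. f n x = (f (Suc n) (x(n := False)) + f (Suc n) (x(n := True))) / 2)"

definition hardy_pow :: "real \<Rightarrow> (nat \<Rightarrow> (nat \<Rightarrow> bool) \<Rightarrow> real) \<Rightarrow> ennreal" where
  "hardy_pow p f = (\<integral>\<^sup>+ x. (SUP n. ennreal (\<bar>f n x\<bar> powr p)) \<partial>walsh_measure)"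

definition weak_pow :: "real \<Rightarrow> ((nat \<Rightarrow> bool) \<Rightarrow> ennreal) \<Rightarrow> ennreal" where
  "weak_pow p g = (SUP t\<in>{0<..}. ennreal (t powr p) *
      emeasure walsh_measure {x \<in> space walsh_measure. g x > ennreal t})"

definition fourier_coeff :: "(nat \<Rightarrow> (nat \<Rightarrow> bool) \<Rightarrow> real) \<Rightarrow> nat \<Rightarrow> real" where
  "fourier_coeff f i = lim (\<lambda>n. \<integral>x. f n x * kaczmarz i x \<partial>walsh_measure)"

definition partial_sum :: "nat \<Rightarrow> (nat \<Rightarrow> (nat \<Rightarrow> bool) \<Rightarrow> real) \<Rightarrow> (nat \<Rightarrow> bool) \<Rightarrow> real" where
  "partial_sum M f x = (\<Sum>i<M. fourier_coeff f i * kaczmarz i x)"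

definition Qsum :: "(nat \<Rightarrow> real) \<Rightarrow> nat \<Rightarrow> real" where
  "Qsum q n = (\<Sum>k<n. q k)"

definition T_mean :: "(nat \<Rightarrow> real) \<Rightarrow> nat \<Rightarrow> (nat \<Rightarrow> (nat \<Rightarrow> bool) \<Rightarrow> real) \<Rightarrow> (nat \<Rightarrow> bool) \<Rightarrow> real" where
  "T_mean q n f x = (1 / Qsum q n) * (\<Sum>k<n. q k * partial_sum k f x)"

definition T_max :: "(nat \<Rightarrow> real) \<Rightarrow> (nat \<Rightarrow> (nat \<Rightarrow> bool) \<Rightarrow> real) \<Rightarrow> (nat \<Rightarrow> bool) \<Rightarrow> ennreal" where
  "T_max q f x = (SUP n\<in>{1..}. ennreal \<bar>T_mean q n f x\<bar>)"

end

theory Submission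
  imports Defs
begin

text \<open>
  For (a), summation by parts and the growth condition bound the T means by the Fejer means, and
  everything may be done on the first \<open>M\<close> coordinates. At height proportional to \<open>\<theta>\<close>, the martingale
  is decomposed into a part bounded by \<open>\<theta>\<close> and differences of stopped martingales at the thresholds
  \<open>\<theta> * 2 ^ k\<close>; each difference is a sum of pieces with mean zero, supported on dyadic intervals.
  On a piece of level \<open>N\<close> the Fejer kernels are dominated, after averaging over the interval, by
  \<open>4 ^ (-N)\<close> times an explicit majorant of the level \<open>N\<close>, uniformly in the index. The sum of these
  majorants, truncated at \<open>\<theta>\<close>, is integrated termwise: truncation is subadditive, and the
  truncated integral of each term is of the order of the square root of the height times the
  measure of the interval. This is the weak type estimate at \<open>p = 1/2\<close>.

  For (b), the increments of \<open>Qsum q n * T_mean q n f\<close> are the partial sums times \<open>q n\<close>, and two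
  consecutive partial sums differ by the single term with index \<open>N = 2 ^ n\<close>. Since \<open>q\<close> is
  non-decreasing, this term is at most \<open>4 * (N + 2)\<close> times the largest of three consecutive means at
  every point, so a Fourier coefficient growing faster than \<open>N\<close> forces one of them to be large on a
  set of measure at least \<open>1/3\<close>.
\<close>

subsection \<open>The dyadic group on finite cubes\<close>

text \<open>The weak quasi-norm at exponent 1/2 is not subadditive, and the pieces of the
  decomposition are controlled only in weak type. Truncation gets around this: because 1/2 < 1, a
  function of weak type 1/2 truncated at \<theta> has an integral of order sqrt \<theta>, and such
  integrals can be added. A piece of height \<open>\<theta> * 2 ^ k\<close> on an interval of
  measure \<open>(1/2) ^ N\<close> costs a multiple of
  \<open>\<theta> * sqrt 2 ^ k * (1/2) ^ N\<close>. Adding over the disjoint intervals and then over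
  k charges each point a geometric sum of \<open>sqrt 2 ^ k\<close>, of order
  \<open>sqrt (f* / \<theta>)\<close> with f* the maximal function; this is where the Hardy
  quasi-norm appears. The argument only closes if the weak type constant of the kernel majorant is
  independent of the level, which is the hard estimate \<open>sum_min_fej_major\<close>.\<close>

definition cube :: "nat \<Rightarrow> (nat \<Rightarrow> bool) set" where
  "cube M = {t. \<forall>j\<ge>M. \<not> t j}"

text \<open>\<open>cube M\<close> holds one representative of each dyadic interval of level
  \<open>M\<close>, the point continued by \<open>False\<close>; \<open>fiber N M c\<close> holds
  those inside the level \<open>N\<close> interval of \<open>c\<close>, where \<open>c\<close> may
  be any point of the group.\<close>

definition fiber :: "nat \<Rightarrow> nat \<Rightarrow> (nat \<Rightarrow> bool) \<Rightarrow> (nat \<Rightarrow> bool) set" where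
  "fiber N M c = {t \<in> cube M. \<forall>j<N. t j = c j}"

definition depends_below :: "nat \<Rightarrow> ((nat \<Rightarrow> bool) \<Rightarrow> 'b) \<Rightarrow> bool" where
  "depends_below M h \<longleftrightarrow> (\<forall>x y. (\<forall>j<M. x j = y j) \<longrightarrow> h x = h y)"

definition add2 :: "(nat \<Rightarrow> bool) \<Rightarrow> (nat \<Rightarrow> bool) \<Rightarrow> nat \<Rightarrow> bool" (infixl "\<oplus>\<^sub>2" 65) where
  "x \<oplus>\<^sub>2 t = (\<lambda>j. x j \<noteq> t j)"

definition trunc :: "nat \<Rightarrow> (nat \<Rightarrow> bool) \<Rightarrow> nat \<Rightarrow> bool" where
  "trunc M x = (\<lambda>j. j < M \<and> x j)"

lemma fiber_0 [simp]: "fiber 0 M c = cube M"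
  by (simp add: fiber_def)

lemma trunc_in_cube [simp]: "trunc M x \<in> cube M"
  by (simp add: trunc_def cube_def)

lemma cube_mono: "N \<le> M \<Longrightarrow> cube N \<subseteq> cube M"
  by (auto simp: cube_def)

lemma depends_belowD:
  assumes "depends_below M h" "\<And>j. j < M \<Longrightarrow> x j = y j"
  shows "h x = h y"
  using assms(1)[unfolded depends_below_def, rule_format, of x y] assms(2) by blast

lemma depends_below_trunc: "depends_below M h \<Longrightarrow> h (trunc M x) = h x"
  by (rule depends_belowD[where h = h]) (auto simp: trunc_def)

lemma depends_below_upd: "depends_below M h \<Longrightarrow> M \<le> k \<Longrightarrow> h (x(k := b)) = h x"
  by (rule depends_belowD[where h = h]) auto

lemma depends_below_add2:
  assumes "depends_below M h" shows "depends_below M (\<lambda>t. h (x \<oplus>\<^sub>2 t))"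
  unfolding depends_below_def
  by (intro allI impI depends_belowD[OF assms]) (simp add: add2_def)

lemma add2_upd: "x \<oplus>\<^sub>2 (t(k := b)) = (x \<oplus>\<^sub>2 t)(k := (x k \<noteq> b))"
  by (auto simp: add2_def fun_eq_iff)

lemma fiber_refl: "fiber N N c = {trunc N c}"
proof -
  have "t = trunc N c" if "t \<in> fiber N N c" for t
  proof
    fix j show "t j = trunc N c j"
      using that by (cases "j < N") (auto simp: fiber_def trunc_def cube_def)
  qed
  moreover have "trunc N c \<in> fiber N N c"
    by (auto simp: fiber_def trunc_def cube_def)
  ultimately show ?thesis by blast
qed

lemma fiber_Suc:
  assumes "N \<le> M"
  shows "fiber N (Suc M) c = fiber N M c \<union> (\<lambda>t. t(M := True)) ` fiber N M c"
proof
  show "fiber N (Suc M) c \<subseteq> fiber N M c \<union> (\<lambda>t. t(M := True)) ` fiber N M c"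
  proof
    fix t assume t: "t \<in> fiber N (Suc M) c"
    show "t \<in> fiber N M c \<union> (\<lambda>t. t(M := True)) ` fiber N M c"
    proof (cases "t M")
      case False
      then have "t \<in> fiber N M c" using t
        by (auto simp: fiber_def cube_def) (metis le_neq_implies_less not_less_eq_eq Suc_leI)
      then show ?thesis by simp
    next
      case True
      then have "t = (t(M := False))(M := True)" by (auto simp: fun_eq_iff)
      moreover have "t(M := False) \<in> fiber N M c"
        using t assms by (auto simp: fiber_def cube_def)
      ultimately show ?thesis by blast
    qed
  qed
  show "fiber N M c \<union> (\<lambda>t. t(M := True)) ` fiber N M c \<subseteq> fiber N (Suc M) c"
    using assms by (auto simp: fiber_def cube_def)
qed

lemma finite_fiber [simp]: "finite (fiber N M c)"
proof (cases "N \<le> M")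
  case True
  then show ?thesis
    by (induction M rule: dec_induct) (simp_all add: fiber_refl fiber_Suc)
next
  case False
  then have "fiber N M c \<subseteq> fiber N N c" by (auto simp: fiber_def cube_def)
  then show ?thesis by (simp add: fiber_refl finite_subset)
qed

lemma finite_cube [simp]: "finite (cube M)"
  using finite_fiber[of 0 M] by simp

text \<open>Engine of the inductions on the level: a point of the coarser cube already has
  \<open>False\<close> at coordinate \<open>M\<close>, so its two children are itself and its
  update.\<close>

lemma sum_fiber_Suc:
  fixes \<phi> :: "_ \<Rightarrow> 'a::comm_monoid_add"
  assumes "N \<le> M"
  shows "(\<Sum>t\<in>fiber N (Suc M) c. \<phi> t) = (\<Sum>t\<in>fiber N M c. \<phi> t + \<phi> (t(M := True)))"
proof -
  have inj: "inj_on (\<lambda>t. t(M := True)) (fiber N M c)"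
  proof (rule inj_onI)
    fix s t assume st: "s \<in> fiber N M c" "t \<in> fiber N M c" "s(M := True) = t(M := True)"
    have "s j = t j" for j
    proof (cases "j = M")
      case True
      then show ?thesis using st(1,2) by (simp add: fiber_def cube_def)
    next
      case False
      then show ?thesis using fun_cong[OF st(3), of j] by simp
    qed
    then show "s = t" by blast
  qed
  have disj: "fiber N M c \<inter> (\<lambda>t. t(M := True)) ` fiber N M c = {}"
    by (auto simp: fiber_def cube_def)
  show ?thesis
    unfolding fiber_Suc[OF assms]
    by (subst sum.union_disjoint) (simp_all add: disj sum.reindex[OF inj] sum.distrib)
qed

lemmas sum_cube_Suc = sum_fiber_Suc[of 0, simplified]

lemma sum_fiber_depends:
  fixes \<phi> :: "_ \<Rightarrow> real"
  assumes "depends_below i \<phi>" "N \<le> i" "i \<le> M"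
  shows "(\<Sum>t\<in>fiber N M c. \<phi> t) = 2 ^ (M - i) * (\<Sum>t\<in>fiber N i c. \<phi> t)"
  using assms(3)
proof (induction M rule: dec_induct)
  case (step M)
  have "\<phi> (t(M := True)) = \<phi> t" for t
    using assms(1) step.hyps by (intro depends_below_upd)
  then have "(\<Sum>t\<in>fiber N (Suc M) c. \<phi> t) = (\<Sum>t\<in>fiber N M c. \<phi> t) + (\<Sum>t\<in>fiber N M c. \<phi> t)"
    using step.hyps assms(2) by (simp add: sum_fiber_Suc sum_distrib_left)
  then show ?case using step
    by (simp add: Suc_diff_le)
qed simp

lemma card_fiber: "N \<le> M \<Longrightarrow> card (fiber N M c) = 2 ^ (M - N)"
proof -
  assume "N \<le> M"
  then have "real (card (fiber N M c)) = 2 ^ (M - N)"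
    using sum_fiber_depends[of N "\<lambda>_. 1" N M c] by (simp add: depends_below_def fiber_refl)
  then show ?thesis by (metis of_nat_eq_iff of_nat_numeral of_nat_power)
qed

lemma card_cube: "card (cube M) = 2 ^ M"
  using card_fiber[of 0 M] by simp

lemma sum_cube_fiber:
  assumes "N \<le> M"
  shows "(\<Sum>t\<in>cube M. \<phi> t) = (\<Sum>c\<in>cube N. \<Sum>t\<in>fiber N M c. \<phi> t)"
proof -
  have un: "cube M = (\<Union>c\<in>cube N. fiber N M c)"
  proof
    show "cube M \<subseteq> (\<Union>c\<in>cube N. fiber N M c)"
    proof
      fix t assume "t \<in> cube M"
      then have "t \<in> fiber N M (trunc N t)" by (auto simp: fiber_def trunc_def)
      then show "t \<in> (\<Union>c\<in>cube N. fiber N M c)" by (meson UN_iff trunc_in_cube)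
    qed
  qed (auto simp: fiber_def)
  have disj: "fiber N M c \<inter> fiber N M d = {}" if "c \<in> cube N" "d \<in> cube N" "c \<noteq> d" for c d
  proof (rule ccontr)
    assume "fiber N M c \<inter> fiber N M d \<noteq> {}"
    then have "\<forall>j<N. c j = d j" by (auto simp: fiber_def)
    then have "c = d" using that(1,2)
      by (intro ext) (metis cube_def linorder_not_less mem_Collect_eq)
    with that(3) show False by simp
  qed
  show ?thesis unfolding un
    by (rule sum.UNION_disjoint) (use disj in auto)
qed

lemma sum_cube_add2:
  assumes "c \<in> cube M"
  shows "(\<Sum>x\<in>cube M. \<phi> (x \<oplus>\<^sub>2 c)) = (\<Sum>x\<in>cube M. \<phi> x)"
  by (rule sum.reindex_bij_witness[where i = "\<lambda>x. x \<oplus>\<^sub>2 c" and j = "\<lambda>x. x \<oplus>\<^sub>2 c"])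
     (use assms in \<open>auto simp: add2_def cube_def\<close>)

section \<open>Cylinder sets and the product measure\<close>

lemma space_walsh [simp]: "space walsh_measure = UNIV"
  by (simp add: walsh_measure_def space_PiM)

lemma prob_space_walsh: "prob_space walsh_measure"
  unfolding walsh_measure_def
  by (intro prob_space_PiM measure_pmf.prob_space_axioms)

definition cyl :: "nat \<Rightarrow> (nat \<Rightarrow> bool) \<Rightarrow> (nat \<Rightarrow> bool) set" where
  "cyl M c = {x. \<forall>j<M. x j = c j}"

lemma cyl_sets_emeasure:
  "cyl M c \<in> sets walsh_measure \<and> emeasure walsh_measure (cyl M c) = ennreal (1 / 2 ^ M)"
proof -
  let ?P = "\<lambda>_::nat. measure_pmf (bernoulli_pmf (1/2))"
  interpret product_prob_space ?P UNIV
    by unfold_locales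
  let ?E = "prod_emb UNIV ?P {..<M} (Pi\<^sub>E {..<M} (\<lambda>j. {c j}))"
  have e: "cyl M c = ?E"
    by (auto simp: cyl_def prod_emb_def PiE_def extensional_def Pi_def restrict_def)
  have s: "?E \<in> sets (PiM UNIV ?P)"
    by (rule sets_PiM_I) auto
  have "emeasure (PiM UNIV ?P) ?E = (\<Prod>j<M. emeasure (?P j) {c j})"
    by (rule emeasure_PiM_emb) auto
  also have "\<dots> = (\<Prod>j<M. ennreal (1/2))"
  proof (intro prod.cong refl)
    fix j show "emeasure (?P j) {c j} = ennreal (1/2)"
      by (cases "c j") (simp_all add: emeasure_pmf_single)
  qed
  also have "\<dots> = ennreal ((1/2) ^ M)"
    unfolding prod_constant by (subst ennreal_power) simp_all
  also have "\<dots> = ennreal (1 / 2 ^ M)"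
    by (simp add: prod_ennreal ennreal_power power_one_over)
  finally show ?thesis using s e by (simp add: walsh_measure_def)
qed

text \<open>Reduces measurability and integration to \<open>cyl_sets_emeasure\<close>, so that the
  analysis can be done by counting points of \<open>cube M\<close>.\<close>

lemma depends_below_expand:
  fixes h :: "_ \<Rightarrow> real"
  assumes "depends_below M h"
  shows "h x = (\<Sum>c\<in>cube M. h c * indicator (cyl M c) x)"
proof -
  have "(\<Sum>c\<in>cube M. h c * indicator (cyl M c) x) = (\<Sum>c\<in>cube M. if c = trunc M x then h c else 0)"
  proof (rule sum.cong[OF refl])
    fix c assume "c \<in> cube M"
    then have "x \<in> cyl M c \<longleftrightarrow> c = trunc M x"
      unfolding cyl_def cube_def trunc_def fun_eq_iff mem_Collect_eq
      by (meson not_le)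
    then show "h c * indicator (cyl M c) x = (if c = trunc M x then h c else 0)"
      by (simp add: indicator_def)
  qed
  also have "\<dots> = h (trunc M x)" by (simp add: sum.delta)
  also have "\<dots> = h x" using assms by (rule depends_below_trunc)
  finally show ?thesis by simp
qed

lemma integral_depends_below:
  fixes h :: "_ \<Rightarrow> real"
  assumes "depends_below M h"
  shows "(\<integral>x. h x \<partial>walsh_measure) = (\<Sum>c\<in>cube M. h c) / 2 ^ M"
proof -
  interpret prob_space walsh_measure by (rule prob_space_walsh)
  have m: "measure walsh_measure (cyl M c) = 1 / 2 ^ M" for c
    by (simp add: measure_def cyl_sets_emeasure)
  have "(\<integral>x. h x \<partial>walsh_measure) = (\<integral>x. (\<Sum>c\<in>cube M. h c * indicator (cyl M c) x) \<partial>walsh_measure)"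
    by (simp add: depends_below_expand[OF assms, symmetric])
  also have "\<dots> = (\<Sum>c\<in>cube M. h c * measure walsh_measure (cyl M c))"
    by (subst Bochner_Integration.integral_sum)
       (use cyl_sets_emeasure in \<open>auto simp: emeasure_eq_measure\<close>)
  finally show ?thesis by (simp add: m sum_divide_distrib)
qed

lemma depends_below_measurable:
  fixes h :: "_ \<Rightarrow> real"
  assumes "depends_below M h"
  shows "h \<in> borel_measurable walsh_measure"
proof -
  have "(\<lambda>x. \<Sum>c\<in>cube M. h c * indicator (cyl M c) x) \<in> borel_measurable walsh_measure"
    by (intro borel_measurable_sum borel_measurable_times borel_measurable_const
        borel_measurable_indicator) (simp add: cyl_sets_emeasure)
  then show ?thesis by (simp add: depends_below_expand[OF assms, symmetric])
qed

lemma nn_integral_depends_below: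
  fixes h :: "_ \<Rightarrow> real"
  assumes "depends_below M h" "\<And>x. h x \<ge> 0"
  shows "(\<integral>\<^sup>+x. ennreal (h x) \<partial>walsh_measure) = ennreal ((\<Sum>c\<in>cube M. h c) / 2 ^ M)"
proof -
  interpret prob_space walsh_measure by (rule prob_space_walsh)
  have "integrable walsh_measure h"
  proof (rule integrable_const_bound[where B = "\<Sum>c\<in>cube M. h c"])
    show "AE x in walsh_measure. norm (h x) \<le> (\<Sum>c\<in>cube M. h c)"
    proof (rule AE_I2)
      fix x
      have "h x = h (trunc M x)" using assms(1) by (simp add: depends_below_trunc)
      also have "\<dots> \<le> (\<Sum>c\<in>cube M. h c)"
        using assms(2) by (intro member_le_sum) auto
      finally show "norm (h x) \<le> (\<Sum>c\<in>cube M. h c)" using assms(2) by simp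
    qed
  qed (use depends_below_measurable[OF assms(1)] in auto)
  then show ?thesis
    using assms by (simp add: nn_integral_eq_integral integral_depends_below)
qed

lemma emeasure_depends_below:
  assumes "depends_below M P"
  shows "{x. P x} \<in> sets walsh_measure"
    "emeasure walsh_measure {x. P x} = ennreal (card {c \<in> cube M. P c} / 2 ^ M)"
proof -
  let ?h = "\<lambda>x. (if P x then 1 else 0) :: real"
  have dep: "depends_below M ?h"
    unfolding depends_below_def
  proof (intro allI impI)
    fix x y :: "nat \<Rightarrow> bool" assume "\<forall>j<M. x j = y j"
    then have "P x = P y" by (intro depends_belowD[OF assms]) auto
    then show "?h x = ?h y" by simp
  qed
  have "?h -` {1} \<inter> space walsh_measure \<in> sets walsh_measure"
    by (rule measurable_sets[OF depends_below_measurable[OF dep]]) simp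
  moreover have eq: "?h -` {1} \<inter> space walsh_measure = {x. P x}" by (auto split: if_splits)
  ultimately show s: "{x. P x} \<in> sets walsh_measure" by simp
  have "emeasure walsh_measure {x. P x} = (\<integral>\<^sup>+x. indicator {x. P x} x \<partial>walsh_measure)"
    using s by simp
  also have "\<dots> = (\<integral>\<^sup>+x. ennreal (?h x) \<partial>walsh_measure)"
    by (intro nn_integral_cong) (simp add: indicator_def)
  also have "\<dots> = ennreal ((\<Sum>c\<in>cube M. ?h c) / 2 ^ M)"
    using dep by (rule nn_integral_depends_below) simp
  also have "(\<Sum>c\<in>cube M. ?h c) = card {c \<in> cube M. P c}"
    by (simp add: sum.If_cases Int_def)
  finally show "emeasure walsh_measure {x. P x} = ennreal (card {c \<in> cube M. P c} / 2 ^ M)" .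
qed

subsection \<open>Kernels in the Kaczmarz enumeration\<close>

text \<open>
  These are the Walsh functions after reversal of the first \<open>A\<close> coordinates: for \<open>m < 2 ^ A\<close>
  one has \<open>kaczmarz (2 ^ A + m) = rademacher A * revwalsh A m\<close>. Because of the reversal the
  lowest bit of \<open>m\<close> is paired with the last coordinate, so everything is computed by a recursion
  that splits off the last coordinate and halves \<open>m\<close>.
\<close>

definition revwalsh :: "nat \<Rightarrow> nat \<Rightarrow> (nat \<Rightarrow> bool) \<Rightarrow> real" where
  "revwalsh A m z = (-1) ^ (\<Sum>k<A. (if bit m k \<and> z (A - 1 - k) then 1 else 0 :: nat))"

definition revdir :: "nat \<Rightarrow> nat \<Rightarrow> (nat \<Rightarrow> bool) \<Rightarrow> real" where
  "revdir A k z = (\<Sum>m<k. revwalsh A m z)"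

definition revfejer :: "nat \<Rightarrow> nat \<Rightarrow> (nat \<Rightarrow> bool) \<Rightarrow> real" where
  "revfejer A n z = (\<Sum>k<n. revdir A k z)"

text \<open>
  Unfolded, \<open>dir_major A z\<close> sums \<open>2 ^ (A - b)\<close> over those \<open>b \<le> A\<close> for which \<open>z\<close> vanishes on \<open>[b, A)\<close>,
  and \<open>fej_major A z\<close> sums \<open>4 ^ A / 2 ^ (a + b)\<close> over those \<open>b \<le> a \<le> A\<close> for which \<open>z\<close> vanishes on
  \<open>[b, A)\<close> with the possible exception of the coordinate \<open>a - 1\<close>.
\<close>

primrec dir_major :: "nat \<Rightarrow> (nat \<Rightarrow> bool) \<Rightarrow> real" where
  "dir_major 0 z = 1"
| "dir_major (Suc A) z = 1 + (if z A then 0 else 2 * dir_major A z)"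

primrec fej_major :: "nat \<Rightarrow> (nat \<Rightarrow> bool) \<Rightarrow> real" where
  "fej_major 0 z = 1"
| "fej_major (Suc A) z = 2 * dir_major A z + 1 + (if z A then 0 else 4 * fej_major A z)"

lemma revwalsh_0 [simp]: "revwalsh 0 m z = 1"
  by (simp add: revwalsh_def)

lemma revwalsh_Suc:
  "revwalsh (Suc A) m z = (if odd m \<and> z A then -1 else 1) * revwalsh A (m div 2) z"
  unfolding revwalsh_def
  by (simp add: sum.lessThan_Suc_shift bit_Suc bit_0 power_add del: sum.lessThan_Suc)

lemma abs_revwalsh [simp]: "\<bar>revwalsh A m z\<bar> = 1"
  by (simp add: revwalsh_def)

lemma revwalsh_add2: "revwalsh A m (x \<oplus>\<^sub>2 t) = revwalsh A m x * revwalsh A m t"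
  by (induction A arbitrary: m) (auto simp: revwalsh_Suc add2_def)

lemma depends_revwalsh: "depends_below A (revwalsh A m)"
  unfolding depends_below_def revwalsh_def
  by (intro allI impI arg_cong[where f = "\<lambda>k. (-1) ^ k"] sum.cong refl) auto

text \<open>The functions with indices \<open>2 * j\<close> and \<open>2 * j + 1\<close> differ only
  by the sign attached to coordinate \<open>A\<close>: a pair cancels if \<open>z A\<close> and
  doubles otherwise.\<close>

lemma revdir_even: "revdir (Suc A) (2 * k) z = (if z A then 0 else 2 * revdir A k z)"
  by (induction k) (auto simp: revdir_def revwalsh_Suc)

lemma revdir_odd: "revdir (Suc A) (Suc (2 * k)) z = (if z A then 0 else 2 * revdir A k z) + revwalsh A k z"
  using revdir_even[of A k z] by (simp add: revdir_def revwalsh_Suc)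

text \<open>Pairing again: the orders \<open>2 * k\<close> and \<open>2 * k + 1\<close> contribute
  \<open>revdir A k\<close> with total weight 4, or 0 if \<open>z A\<close>, and one unpaired
  \<open>revwalsh A k\<close>; the unpaired functions add up to \<open>revdir A n\<close>.\<close>

lemma revfejer_even:
  "revfejer (Suc A) (2 * n) z = (if z A then 0 else 4 * revfejer A n z) + revdir A n z"
proof (induction n)
  case (Suc n)
  have "revfejer (Suc A) (2 * Suc n) z
      = revfejer (Suc A) (2 * n) z + revdir (Suc A) (2 * n) z + revdir (Suc A) (Suc (2 * n)) z"
    by (simp add: revfejer_def)
  also have "\<dots> = (if z A then 0 else 4 * revfejer A (Suc n) z) + revdir A (Suc n) z"
    unfolding Suc revdir_even revdir_odd by (simp add: revfejer_def revdir_def)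
  finally show ?case .
qed (simp add: revfejer_def revdir_def)

lemma revfejer_odd:
  "revfejer (Suc A) (Suc (2 * n)) z
    = (if z A then 0 else 4 * revfejer A n z + 2 * revdir A n z) + revdir A n z"
  using revfejer_even[of A n z] revdir_even[of A n z] by (simp add: revfejer_def)

lemma dir_major_ge_1: "dir_major A z \<ge> 1"
  by (induction A) auto

lemma fej_major_ge_dir_major: "fej_major A z \<ge> dir_major A z"
proof (cases A)
  case (Suc B)
  have "fej_major B z \<ge> 0" for B by (induction B) (use dir_major_ge_1 in \<open>auto intro!: add_nonneg_nonneg order_trans[OF zero_le_one dir_major_ge_1]\<close>)
  then show ?thesis using Suc dir_major_ge_1[of B z] by simp
qed simp

lemma fej_major_ge_1: "fej_major A z \<ge> 1"
  using fej_major_ge_dir_major dir_major_ge_1 order_trans by blast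

lemma depends_dir_major: "depends_below A (dir_major A)"
  by (induction A) (auto simp: depends_below_def)

lemma depends_fej_major: "depends_below A (fej_major A)"
proof (induction A)
  case (Suc A)
  show ?case
    unfolding depends_below_def
  proof (intro allI impI)
    fix x y :: "nat \<Rightarrow> bool" assume xy: "\<forall>j<Suc A. x j = y j"
    have "fej_major A x = fej_major A y" by (rule depends_belowD[OF Suc]) (use xy in auto)
    moreover have "dir_major A x = dir_major A y" by (rule depends_belowD[OF depends_dir_major]) (use xy in auto)
    ultimately show "fej_major (Suc A) x = fej_major (Suc A) y" using xy by simp
  qed
qed (simp add: depends_below_def)

lemma even_odd_cases:
  fixes n :: nat
  obtains k where "n = 2 * k" | k where "n = Suc (2 * k)"
  by (metis evenE oddE Suc_eq_plus1)

text \<open>\<open>dir_major\<close> follows the recursions of \<open>revdir_even\<close> and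
  \<open>revdir_odd\<close> with the unpaired Walsh function replaced by 1, so a single majorant
  serves all orders up to \<open>2 ^ A\<close>.\<close>

lemma abs_revdir_le: "k \<le> 2 ^ A \<Longrightarrow> \<bar>revdir A k z\<bar> \<le> dir_major A z"
proof (induction A arbitrary: k)
  case 0
  then show ?case by (simp add: revdir_def)
next
  case (Suc A)
  show ?case
  proof (cases k rule: even_odd_cases)
    case (1 j)
    then have "\<bar>revdir A j z\<bar> \<le> dir_major A z" using Suc by simp
    then show ?thesis using 1 dir_major_ge_1[of A z] by (auto simp: revdir_even abs_le_iff)
  next
    case (2 j)
    then have "\<bar>revdir A j z\<bar> \<le> dir_major A z" using Suc by simp
    moreover have "revwalsh A j z \<le> 1" "- revwalsh A j z \<le> 1"
      using abs_revwalsh[of A j z] by linarith+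
    ultimately show ?thesis using 2 by (auto simp: revdir_odd abs_le_iff)
  qed
qed

text \<open>The constant 3/2 is dictated by odd \<open>n\<close> at points without
  \<open>z A\<close>: the step produces 3 copies of \<open>revdir A j\<close>, while the recursion
  of \<open>fej_major\<close> offers 2 copies of \<open>dir_major A z\<close>.\<close>

lemma abs_revfejer_le: "n \<le> 2 ^ A \<Longrightarrow> \<bar>revfejer A n z\<bar> \<le> 3 / 2 * fej_major A z"
proof (induction A arbitrary: n)
  case 0
  then have "n = 0 \<or> n = 1" by auto
  then show ?case by (auto simp: revfejer_def revdir_def)
next
  case (Suc A)
  have V: "dir_major A z \<ge> 1" by (rule dir_major_ge_1)
  show ?case
  proof (cases n rule: even_odd_cases)
    case (1 j)
    then have "j \<le> 2 ^ A" using Suc by simp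
    then have b: "\<bar>revfejer A j z\<bar> \<le> 3 / 2 * fej_major A z" "\<bar>revdir A j z\<bar> \<le> dir_major A z"
      using Suc.IH abs_revdir_le by auto
    show ?thesis
    proof (cases "z A")
      case True
      then have "revfejer (Suc A) n z = revdir A j z" "fej_major (Suc A) z = 2 * dir_major A z + 1"
        using 1 by (simp_all add: revfejer_even)
      then show ?thesis using b V by linarith
    next
      case False
      then have "revfejer (Suc A) n z = 4 * revfejer A j z + 1 * revdir A j z"
        "fej_major (Suc A) z = 2 * dir_major A z + 1 + 4 * fej_major A z"
        using 1 by (simp_all add: revfejer_even)
      then show ?thesis using b V by linarith
    qed
  next
    case (2 j)
    then have "j \<le> 2 ^ A" using Suc by simp
    then have b: "\<bar>revfejer A j z\<bar> \<le> 3 / 2 * fej_major A z" "\<bar>revdir A j z\<bar> \<le> dir_major A z"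
      using Suc.IH abs_revdir_le by auto
    show ?thesis
    proof (cases "z A")
      case True
      then have "revfejer (Suc A) n z = revdir A j z" "fej_major (Suc A) z = 2 * dir_major A z + 1"
        using 2 by (simp_all add: revfejer_odd)
      then show ?thesis using b V by linarith
    next
      case False
      then have "revfejer (Suc A) n z = 4 * revfejer A j z + 3 * revdir A j z"
        "fej_major (Suc A) z = 2 * dir_major A z + 1 + 4 * fej_major A z"
        using 2 by (simp_all add: revfejer_odd)
      then show ?thesis using b V by linarith
    qed
  qed
qed

lemma revdir_full: "revdir A (2 ^ A) z = (if \<forall>j<A. \<not> z j then 2 ^ A else 0)"
proof (induction A)
  case (Suc A)
  then show ?case using revdir_even[of A "2 ^ A" z] by (auto simp: less_Suc_eq)
qed (simp add: revdir_def)

text \<open>At each coordinate from \<open>N\<close> on, exactly one of the two values makes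
  \<open>x \<oplus>\<^sub>2 t\<close> vanish there, so two children always sum to
  \<open>2 + 2 * dir_major\<close>. The constants accumulate to the logarithmic excess
  \<open>A - N\<close>.\<close>

lemma sum_dir_major:
  assumes "N \<le> A"
  shows "(\<Sum>t\<in>fiber N A c. dir_major A (x \<oplus>\<^sub>2 t)) = 2 ^ (A - N) * (dir_major N (x \<oplus>\<^sub>2 c) + real (A - N))"
  using assms
proof (induction A rule: dec_induct)
  case base
  have "dir_major N (x \<oplus>\<^sub>2 trunc N c) = dir_major N (x \<oplus>\<^sub>2 c)"
    by (rule depends_belowD[OF depends_dir_major]) (simp add: add2_def trunc_def)
  then show ?case by (simp add: fiber_refl)
next
  case (step A)
  have "(\<Sum>t\<in>fiber N (Suc A) c. dir_major (Suc A) (x \<oplus>\<^sub>2 t))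
      = (\<Sum>t\<in>fiber N A c. dir_major (Suc A) (x \<oplus>\<^sub>2 t) + dir_major (Suc A) (x \<oplus>\<^sub>2 (t(A := True))))"
    using step.hyps(1) by (rule sum_fiber_Suc)
  also have "\<dots> = (\<Sum>t\<in>fiber N A c. 2 + 2 * dir_major A (x \<oplus>\<^sub>2 t))"
  proof (intro sum.cong refl)
    fix t assume "t \<in> fiber N A c"
    then have "(x \<oplus>\<^sub>2 t) A = x A" by (simp add: add2_def fiber_def cube_def)
    then show "dir_major (Suc A) (x \<oplus>\<^sub>2 t) + dir_major (Suc A) (x \<oplus>\<^sub>2 (t(A := True))) = 2 + 2 * dir_major A (x \<oplus>\<^sub>2 t)"
      by (simp add: add2_upd depends_below_upd[OF depends_dir_major])
  qed
  also have "\<dots> = 2 ^ (Suc A - N) * (dir_major N (x \<oplus>\<^sub>2 c) + real (Suc A - N))"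
    using step by (simp add: sum.distrib sum_distrib_left[symmetric] card_fiber Suc_diff_le algebra_simps)
  finally show ?case .
qed

lemma sum_fej_major_eq:
  assumes "N \<le> A"
  shows "(\<Sum>t\<in>fiber N A c. fej_major A (x \<oplus>\<^sub>2 t))
    = 4 ^ (A - N) * (fej_major N (x \<oplus>\<^sub>2 c) + 2 * dir_major N (x \<oplus>\<^sub>2 c) + 3)
      - 2 ^ (A - N) * (2 * dir_major N (x \<oplus>\<^sub>2 c) + 2 * real (A - N) + 3)"
  using assms
proof (induction A rule: dec_induct)
  case base
  have "fej_major N (x \<oplus>\<^sub>2 trunc N c) = fej_major N (x \<oplus>\<^sub>2 c)"
    by (rule depends_belowD[OF depends_fej_major]) (simp add: add2_def trunc_def)
  then show ?case by (simp add: fiber_refl)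
next
  case (step A)
  have "(\<Sum>t\<in>fiber N (Suc A) c. fej_major (Suc A) (x \<oplus>\<^sub>2 t))
      = (\<Sum>t\<in>fiber N A c. fej_major (Suc A) (x \<oplus>\<^sub>2 t) + fej_major (Suc A) (x \<oplus>\<^sub>2 (t(A := True))))"
    using step.hyps(1) by (rule sum_fiber_Suc)
  also have "\<dots> = (\<Sum>t\<in>fiber N A c. 4 * dir_major A (x \<oplus>\<^sub>2 t) + 2 + 4 * fej_major A (x \<oplus>\<^sub>2 t))"
  proof (intro sum.cong refl)
    fix t assume "t \<in> fiber N A c"
    then have "(x \<oplus>\<^sub>2 t) A = x A" by (simp add: add2_def fiber_def cube_def)
    then show "fej_major (Suc A) (x \<oplus>\<^sub>2 t) + fej_major (Suc A) (x \<oplus>\<^sub>2 (t(A := True)))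
        = 4 * dir_major A (x \<oplus>\<^sub>2 t) + 2 + 4 * fej_major A (x \<oplus>\<^sub>2 t)"
      by (simp add: add2_upd depends_below_upd[OF depends_dir_major] depends_below_upd[OF depends_fej_major])
  qed
  also have "\<dots> = 4 * (\<Sum>t\<in>fiber N A c. dir_major A (x \<oplus>\<^sub>2 t)) + 2 * 2 ^ (A - N)
      + 4 * (\<Sum>t\<in>fiber N A c. fej_major A (x \<oplus>\<^sub>2 t))"
    using step.hyps by (simp add: sum.distrib sum_distrib_left card_fiber)
  finally show ?case
    using step by (simp add: sum_dir_major Suc_diff_le algebra_simps)
qed

text \<open>The 6 is 1 + 2 + 3, by \<open>1 \<le> dir_major \<le> fej_major\<close>. What remains of
  \<open>A\<close> is a pure power, which the normalisations of the convolution and of the Fejer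
  mean will cancel.\<close>

lemma sum_fej_major_le:
  assumes "N \<le> A"
  shows "(\<Sum>t\<in>fiber N A c. fej_major A (x \<oplus>\<^sub>2 t)) \<le> 6 * 4 ^ (A - N) * fej_major N (x \<oplus>\<^sub>2 c)"
proof -
  let ?U = "fej_major N (x \<oplus>\<^sub>2 c)" and ?V = "dir_major N (x \<oplus>\<^sub>2 c)"
  have V: "?V \<ge> 1" "?U \<ge> ?V" by (rule dir_major_ge_1, rule fej_major_ge_dir_major)
  have "(\<Sum>t\<in>fiber N A c. fej_major A (x \<oplus>\<^sub>2 t)) \<le> 4 ^ (A - N) * (?U + 2 * ?V + 3)"
    unfolding sum_fej_major_eq[OF assms] using V by simp
  also have "\<dots> \<le> 4 ^ (A - N) * (6 * ?U)"
    using V by (intro mult_left_mono) auto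
  finally show ?thesis by (simp add: mult_ac)
qed

section \<open>From the reversed Walsh functions to the Kaczmarz kernels\<close>

lemma bit_add_lead:
  fixes m :: nat
  assumes "m < 2 ^ A"
  shows "bit (2 ^ A + m) k \<longleftrightarrow> k = A \<or> (k < A \<and> bit m k)"
proof -
  consider "k < A" | "k = A" | "k > A" by linarith
  then show ?thesis
  proof cases
    case 1
    have "take_bit A (2 ^ A + m) = take_bit A m" by (simp add: take_bit_eq_mod)
    then have "bit (take_bit A (2 ^ A + m)) k = bit (take_bit A m) k" by simp
    then show ?thesis using 1 by (simp add: bit_take_bit_iff)
  next
    case 2
    then show ?thesis using assms by (simp add: bit_iff_odd)
  next
    case 3
    then have "(2::nat) ^ Suc A \<le> 2 ^ k" by (intro power_increasing) auto
    then have "2 ^ A + m < 2 ^ k" using assms by simp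
    then show ?thesis using 3 by (simp add: bit_iff_odd)
  qed
qed

lemma lead_add:
  assumes "m < 2 ^ A" shows "lead (2 ^ A + m) = A"
  unfolding lead_def
  by (rule Greatest_equality) (use assms in \<open>auto simp: bit_add_lead\<close>)

lemma kaczmarz_add:
  assumes "m < 2 ^ A"
  shows "kaczmarz (2 ^ A + m) z = rademacher A z * revwalsh A m z"
proof -
  have "(\<Sum>k<A. if bit (2 ^ A + m) k \<and> z (A - 1 - k) then 1 else 0)
      = (\<Sum>k<A. if bit m k \<and> z (A - 1 - k) then 1 else 0 :: nat)"
    using assms by (intro sum.cong refl) (auto simp: bit_add_lead)
  then show ?thesis using assms by (simp add: kaczmarz_def lead_add revwalsh_def)
qed

lemma kaczmarz_0 [simp]: "kaczmarz 0 z = 1"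
  by (simp add: kaczmarz_def)

lemma dyadic_split:
  fixes n :: nat
  assumes "n \<ge> 1"
  obtains A m where "n = 2 ^ A + m" "m < 2 ^ A"
proof -
  obtain A where A: "2 ^ A \<le> n" "n < 2 ^ (A + 1)"
    using assms ex_power_ivl1[of 2 n] by auto
  show thesis by (rule that[of A "n - 2 ^ A"]) (use A in auto)
qed

lemma rademacher_add2: "rademacher A (x \<oplus>\<^sub>2 t) = rademacher A x * rademacher A t"
  by (auto simp: rademacher_def add2_def)

text \<open>Each Kaczmarz function is a character of the group; this turns partial sums into
  convolutions.\<close>

lemma kaczmarz_add2: "kaczmarz i (x \<oplus>\<^sub>2 t) = kaczmarz i x * kaczmarz i t"
proof (cases "i = 0")
  case False
  then obtain A m where "i = 2 ^ A + m" "m < 2 ^ A" using dyadic_split[of i] by auto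
  then show ?thesis by (simp add: kaczmarz_add rademacher_add2 revwalsh_add2)
qed simp

lemma depends_kaczmarz:
  assumes "i < 2 ^ M" shows "depends_below M (kaczmarz i)"
proof (cases "i = 0")
  case False
  then obtain A m where *: "i = 2 ^ A + m" "m < 2 ^ A" using dyadic_split[of i] by auto
  have "(2::nat) ^ A < 2 ^ M" using assms * by linarith
  then have "A < M" by simp
  have "depends_below A (revwalsh A m)" by (rule depends_revwalsh)
  then show ?thesis unfolding * kaczmarz_add[OF *(2)] depends_below_def
    using \<open>A < M\<close> by (auto simp: rademacher_def)
qed (simp add: depends_below_def)

definition kdir :: "nat \<Rightarrow> (nat \<Rightarrow> bool) \<Rightarrow> real" where
  "kdir k z = (\<Sum>i<k. kaczmarz i z)"

definition kfejer :: "nat \<Rightarrow> (nat \<Rightarrow> bool) \<Rightarrow> real" where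
  "kfejer n z = (\<Sum>k<n. kdir k z)"

lemma kdir_add:
  assumes "j \<le> 2 ^ A"
  shows "kdir (2 ^ A + j) z = kdir (2 ^ A) z + rademacher A z * revdir A j z"
  using assms
proof (induction j)
  case (Suc j)
  moreover have "kaczmarz (2 ^ A + j) z = rademacher A z * revwalsh A j z"
    using Suc.prems by (intro kaczmarz_add) simp
  ultimately show ?case by (simp add: kdir_def revdir_def distrib_left)
qed (simp add: revdir_def)

text \<open>Passing from \<open>A\<close> to \<open>Suc A\<close> adds the old kernel times
  \<open>rademacher A\<close>, which doubles or cancels it. At orders \<open>2 ^ A\<close> the
  kernel is thus the same as in the Paley enumeration.\<close>

lemma kdir_full: "kdir (2 ^ A) z = (if \<forall>j<A. \<not> z j then 2 ^ A else 0)"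
proof (induction A)
  case (Suc A)
  have "kdir (2 ^ Suc A) z = kdir (2 ^ A) z + rademacher A z * revdir A (2 ^ A) z"
    using kdir_add[of "2 ^ A" A z] by (simp add: mult_2)
  then show ?case unfolding Suc revdir_full by (auto simp: less_Suc_eq rademacher_def)
qed (simp add: kdir_def)

lemma kfejer_add:
  assumes "m \<le> 2 ^ A"
  shows "kfejer (2 ^ A + m) z
    = kfejer (2 ^ A) z + real m * kdir (2 ^ A) z + rademacher A z * revfejer A m z"
  using assms
proof (induction m)
  case (Suc m)
  then show ?case
    using kdir_add[of m A z] by (simp add: kfejer_def revfejer_def algebra_simps)
qed (simp add: revfejer_def)

subsection \<open>Distribution of the kernel majorant\<close>

text \<open>The minimum lies below every weighted geometric mean; the freedom in the exponent is
  exploited at 1/4 and 3/4.\<close>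

lemma min_le_powr_mult:
  fixes c l a :: real
  assumes "c > 0" "l > 0" "0 \<le> a" "a \<le> 1"
  shows "min c l \<le> c powr (1 - a) * l powr a"
proof -
  let ?m = "min c l"
  have m: "?m > 0" using assms by simp
  have "?m = ?m powr (1 - a) * ?m powr a" using m by (simp flip: powr_add)
  also have "\<dots> \<le> c powr (1 - a) * l powr a"
    using m assms by (intro mult_mono powr_mono2) auto
  finally show ?thesis .
qed

lemma min_add_le:
  fixes a b l :: real
  assumes "a \<ge> 0" "b \<ge> 0" "l \<ge> 0"
  shows "min (a + b) l \<le> min a l + min b l"
  using assms by (auto simp: min_def)

lemma min_sum_le:
  fixes f :: "'a \<Rightarrow> real"
  assumes "finite S" "\<And>i. i \<in> S \<Longrightarrow> f i \<ge> 0" "l \<ge> 0"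
  shows "min (\<Sum>i\<in>S. f i) l \<le> (\<Sum>i\<in>S. min (f i) l)"
  using assms(1,2)
proof (induction S rule: finite_induct)
  case (insert i S)
  then have "min (f i + (\<Sum>i\<in>S. f i)) l \<le> min (f i) l + min (\<Sum>i\<in>S. f i) l"
    using assms(3) by (intro min_add_le) (auto intro: sum_nonneg)
  then show ?case using insert by simp
qed (use assms in auto)

text \<open>Since \<open>min (2 * u) l = 2 * min u (l / 2)\<close>, one level of the recursion
  halves the truncation height and gains the factor \<open>2 powr (- a)\<close>; the constant is the
  sum of the resulting geometric series.\<close>

lemma sum_min_dir_major:
  fixes c l a :: real
  assumes "c > 0" "l > 0" "0 < a" "a \<le> 1"
  shows "(\<Sum>x\<in>cube N. min (c * dir_major N x) l)
    \<le> 2 ^ N * (1 / (1 - 2 powr (- a))) * (c powr (1 - a) * l powr a)"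
  using assms(2)
proof (induction N arbitrary: l)
  case 0
  have "1 - 2 powr (-a) \<le> (1::real)" "1 - 2 powr (-a) > (0::real)" using assms(3)
    by (auto simp: powr_minus powr_gt_zero less_imp_le divide_less_eq field_simps)
  then have K: "1 / (1 - 2 powr (-a)) \<ge> (1::real)" by simp
  have "(\<Sum>x\<in>cube 0. min (c * dir_major 0 x) l) = min c l"
    using fiber_refl[of 0 "\<lambda>_. False"] by simp
  also have "\<dots> \<le> 1 * (c powr (1 - a) * l powr a)"
    using min_le_powr_mult[of c l a] assms 0 by simp
  also have "\<dots> \<le> (1 / (1 - 2 powr (-a))) * (c powr (1 - a) * l powr a)"
    using K by (intro mult_right_mono) auto
  finally show ?case by simp
next
  case (Suc N)
  let ?K = "1 / (1 - 2 powr (- a)) :: real" and ?X = "c powr (1 - a) * l powr a"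
  have q: "1 - 2 powr (-a) > (0::real)" using assms(3)
    by (auto simp: powr_minus field_simps)
  have "(\<Sum>x\<in>cube (Suc N). min (c * dir_major (Suc N) x) l)
      = (\<Sum>t\<in>cube N. min (c * dir_major (Suc N) t) l + min (c * dir_major (Suc N) (t(N := True))) l)"
    by (rule sum_cube_Suc)
  also have "\<dots> \<le> (\<Sum>t\<in>cube N. 2 * ?X + 2 * min (c * dir_major N t) (l / 2))"
  proof (rule sum_mono)
    fix t assume "t \<in> cube N"
    then have t: "\<not> t N" by (simp add: cube_def)
    have m: "min c l \<le> ?X" using min_le_powr_mult[of c l a] assms Suc.prems by simp
    have "min (c * dir_major (Suc N) t) l = min (c + 2 * (c * dir_major N t)) l"
      using t by (simp add: algebra_simps)
    also have "\<dots> \<le> min c l + min (2 * (c * dir_major N t)) l"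
      using assms Suc.prems dir_major_ge_1[of N t] by (intro min_add_le) auto
    also have "min (2 * (c * dir_major N t)) l = 2 * min (c * dir_major N t) (l / 2)"
      by (auto simp: min_def)
    finally have "min (c * dir_major (Suc N) t) l \<le> ?X + 2 * min (c * dir_major N t) (l / 2)" using m by linarith
    moreover have "min (c * dir_major (Suc N) (t(N := True))) l = min c l" by simp
    ultimately show "min (c * dir_major (Suc N) t) l + min (c * dir_major (Suc N) (t(N := True))) l
        \<le> 2 * ?X + 2 * min (c * dir_major N t) (l / 2)" using m by linarith
  qed
  also have "\<dots> = 2 ^ Suc N * ?X + 2 * (\<Sum>t\<in>cube N. min (c * dir_major N t) (l / 2))"
    by (simp add: sum.distrib card_cube sum_distrib_left)
  also have "\<dots> \<le> 2 ^ Suc N * ?X + 2 * (2 ^ N * ?K * (c powr (1 - a) * (l / 2) powr a))"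
    using Suc.IH[of "l / 2"] Suc.prems by (intro add_left_mono mult_left_mono) auto
  also have "(l / 2) powr a = l powr a * 2 powr (-a)"
    using Suc.prems by (simp add: powr_divide powr_minus field_simps)
  also have "2 ^ Suc N * ?X + 2 * (2 ^ N * ?K * (c powr (1 - a) * (l powr a * 2 powr (-a))))
      = 2 ^ Suc N * (1 + ?K * 2 powr (-a)) * ?X"
    by (simp add: algebra_simps)
  also have "1 + ?K * 2 powr (-a) = ?K"
  proof -
    have "1 + 1 / (1 - z) * z = 1 / (1 - z)" if "1 - z > 0" for z :: real
      using that by (simp add: field_simps)
    then show ?thesis using q by blast
  qed
  finally show ?case .
qed

text \<open>
  Potential for the induction on \<open>N\<close> in \<open>sum_min_fej_major\<close>: replacing \<open>c\<close> by \<open>4 * c\<close> multiplies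
  \<open>(c / l) powr (1/4)\<close> by \<open>sqrt 2\<close>, and \<open>pot\<close> decreases by at least the contribution of that step.
\<close>

definition pot :: "real \<Rightarrow> real" where
  "pot y = (let q = sqrt 2; B = 1 / (1 - 1 / q); e = 1 / (q - 1)
     in if y \<ge> 1 then B / y else 1 + B + e - e * y)"

text \<open>\<open>pot y\<close> dominates the sum of \<open>min z (1 / z)\<close> over
  \<open>z = y, q * y, q ^ 2 * y, ...\<close> with \<open>q = sqrt 2\<close>. From 1 on, the terms
  \<open>1 / z\<close> sum to \<open>B / y\<close>; below 1 the terms \<open>z\<close> telescope
  through \<open>e * z\<close>, and the extra 1 pays for the step across 1.\<close>

lemma pot_nonneg: "y > 0 \<Longrightarrow> pot y \<ge> 0"
  and pot_bounded: "\<exists>K>0. \<forall>y>0. pot y \<le> K"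
  and pot_step: "y > 0 \<Longrightarrow> min y (1 / y) + pot (sqrt 2 * y) \<le> pot y"
proof -
  define q where "q = sqrt 2"
  define B where "B = 1 / (1 - 1 / q)"
  define e where "e = 1 / (q - 1)"
  have q: "q > 1" by (simp add: q_def)
  then have B: "B > 0" and e: "e > 0" by (simp_all add: B_def e_def)
  have pot: "pot y = (if y \<ge> 1 then B / y else 1 + B + e - e * y)" for y
    by (simp add: pot_def Let_def B_def e_def q_def)
  have nn: "pot y \<ge> 0" if "y > 0" for y
  proof (cases "y \<ge> 1")
    case False
    then have "e * y \<le> e * 1" using e by (intro mult_left_mono) auto
    then show ?thesis using False B by (simp add: pot)
  qed (use B in \<open>simp add: pot\<close>)
  then show "pot y \<ge> 0" if "y > 0" using that by simp
  have "pot y \<le> 1 + B + e" if "y > 0" for y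
  proof (cases "y \<ge> 1")
    case True
    then have "B / y \<le> B" using B by (simp add: field_simps)
    then show ?thesis using True e by (simp add: pot)
  next
    case False
    then show ?thesis using e that by (simp add: pot)
  qed
  then show "\<exists>K>0. \<forall>y>0. pot y \<le> K" using B e by (intro exI[of _ "1 + B + e"]) auto
  show "min y (1 / y) + pot (sqrt 2 * y) \<le> pot y" if y: "y > 0"
  proof -
    consider "y \<ge> 1" | "y < 1" "q * y \<ge> 1" | "y < 1" "q * y < 1" by linarith
    then have "min y (1 / y) + pot (q * y) \<le> pot y"
    proof cases
      case 1
      have "1 * 1 \<le> q * y" using q 1 by (intro mult_mono) auto
      then have "pot (q * y) = B / (q * y)" "pot y = B / y" using 1 by (simp_all add: pot)
      moreover have "1 / y + B / (q * y) = B / y"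
        using q y by (simp add: B_def field_simps)
      ultimately show ?thesis by linarith
    next
      case 2
      have "B / (q * y) \<le> B" using 2 B by (simp add: divide_le_eq)
      moreover have "e * y \<le> e * 1" using 2 e by (intro mult_left_mono) auto
      moreover have "pot (q * y) = B / (q * y)" "pot y = 1 + B + e - e * y"
        using 2 by (simp_all add: pot)
      ultimately show ?thesis using 2 by linarith
    next
      case 3
      have "pot (q * y) = 1 + B + e - e * (q * y)" "pot y = 1 + B + e - e * y"
        using 3 by (simp_all add: pot)
      moreover have "y + (e * y - e * (q * y)) = 0"
      proof -
        have "e * (q - 1) = 1" using q by (simp add: e_def)
        then have "y * (e * (q - 1)) = y" by simp
        then show ?thesis by (simp add: algebra_simps)
      qed
      ultimately show ?thesis by linarith
    qed
    then show ?thesis by (simp add: q_def)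
  qed
qed

text \<open>With \<open>r = (c / l) powr (1/4)\<close>, exponents symmetric about 1/2 give the
  bounds \<open>sqrt (c * l) * r\<close> and \<open>sqrt (c * l) / r\<close>; the smaller one
  improves as \<open>c / l\<close> moves away from 1 in either direction.\<close>

lemma powr_quarter:
  fixes c l :: real
  assumes "c > 0" "l > 0"
  shows "c powr (1 - 1/4) * l powr (1/4) = sqrt (c * l) * (c / l) powr (1/4)"
    and "c powr (1 - 3/4) * l powr (3/4) = sqrt (c * l) * (1 / (c / l) powr (1/4))"
proof -
  have "c powr (3/4) = c powr (1/2) * c powr (1/4)" "l powr (3/4) = l powr (1/2) * l powr (1/4)"
    "c powr (1/2) = c powr (1/4) * c powr (1/4)" "l powr (1/2) = l powr (1/4) * l powr (1/4)"
    by (simp_all flip: powr_add)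
  moreover have "c powr (1/4) > 0" "l powr (1/4) > 0" using assms by auto
  moreover have "sqrt (c * l) = c powr (1/2) * l powr (1/2)"
    using assms by (simp add: powr_half_sqrt real_sqrt_mult)
  ultimately show "c powr (1 - 1/4) * l powr (1/4) = sqrt (c * l) * (c / l) powr (1/4)"
    "c powr (1 - 3/4) * l powr (3/4) = sqrt (c * l) * (1 / (c / l) powr (1/4))"
    using assms by (simp_all add: powr_divide field_simps)
qed

text \<open>Weak type 1/2 of \<open>fej_major\<close>, uniformly in the level. The main term of the
  recursion has \<open>4 * c\<close> in place of \<open>c\<close>, and
  \<open>sqrt (4 * c * l) = 2 * sqrt (c * l)\<close> exactly matches the doubling of the cube. With
  no slack there, the \<open>dir_major\<close> terms, one per level, must be summable: bounding each
  by \<open>sqrt (c * l)\<close> would cost a factor \<open>N\<close>, whereas the factor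
  \<open>min r (1 / r)\<close> in \<open>psi\<close> decays geometrically.\<close>

lemma sum_min_fej_major: "\<exists>C>0. \<forall>N c l. c > 0 \<longrightarrow> l > 0 \<longrightarrow>
  (\<Sum>x\<in>cube N. min (c * fej_major N x) l) \<le> C * 2 ^ N * sqrt (c * l)"
proof -
  define K where "K = 1 / (1 - 2 powr (- (1/4))) + 1 / (1 - 2 powr (- (3/4)) :: real)"
  have lt: "2 powr (- (1/4)) < (1::real)" "2 powr (- (3/4)) < (1::real)" by (simp_all add: powr_minus field_simps)
  have pos: "2 powr (- (1/4)) > (0::real)" "2 powr (- (3/4)) > (0::real)" by simp_all
  have k: "1 / (1 - 2 powr (- (1/4))) \<ge> (1::real)" "1 / (1 - 2 powr (- (3/4))) \<ge> (1::real)"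
    using lt pos by (simp_all add: le_divide_eq)
  then have K: "K \<ge> 1" "1 / (1 - 2 powr (- (1/4))) \<le> K" "1 / (1 - 2 powr (- (3/4))) \<le> K"
    unfolding K_def by linarith+
  \<comment> \<open>The 3 stems from \<open>2 * dir_major + 1 \<le> 3 * dir_major\<close> in the
    recursion of \<open>fej_major\<close>.\<close>
  have psi: "(\<Sum>x\<in>cube N. min (3 * c * dir_major N x) l)
      \<le> 2 ^ N * (3 * K) * sqrt (c * l) * min ((c / l) powr (1/4)) (1 / (c / l) powr (1/4))"
    if c: "c > 0" "l > 0" for N c l
  proof -
    have m: "min (3 * c * dir_major N x) l \<le> 3 * min (c * dir_major N x) l" for x
    proof -
      have "0 \<le> c * dir_major N x" using c dir_major_ge_1[of N x] by simp
      then show ?thesis using c by (auto simp: min_def)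
    qed
    have "(\<Sum>x\<in>cube N. min (c * dir_major N x) l) \<le> 2 ^ N * K * (c powr (1 - a) * l powr a)"
      if "a = 1/4 \<or> a = 3/4" for a
    proof -
      have "(\<Sum>x\<in>cube N. min (c * dir_major N x) l)
          \<le> 2 ^ N * (1 / (1 - 2 powr (- a))) * (c powr (1 - a) * l powr a)"
        using c that by (intro sum_min_dir_major) auto
      also have "\<dots> \<le> 2 ^ N * K * (c powr (1 - a) * l powr a)"
      proof -
        have "1 / (1 - 2 powr (- a)) \<le> K" using that
        proof
          assume "a = 1/4" then show ?thesis using K(2) by (simp only:)
        next
          assume "a = 3/4" then show ?thesis using K(3) by (simp only:)
        qed
        then show ?thesis by (intro mult_left_mono mult_right_mono) auto
      qed
      finally show ?thesis .
    qed
    from this[of "1/4"] this[of "3/4"]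
    have s: "(\<Sum>x\<in>cube N. min (c * dir_major N x) l) \<le> 2 ^ N * K * sqrt (c * l) * (c / l) powr (1/4)"
      "(\<Sum>x\<in>cube N. min (c * dir_major N x) l) \<le> 2 ^ N * K * sqrt (c * l) * (1 / (c / l) powr (1/4))"
      unfolding powr_quarter[OF c] by (simp_all add: mult.assoc)
    let ?r = "(c / l) powr (1/4)"
    have s3: "(\<Sum>x\<in>cube N. min (3 * c * dir_major N x) l) \<le> 3 * (\<Sum>x\<in>cube N. min (c * dir_major N x) l)"
      unfolding sum_distrib_left by (intro sum_mono m)
    show ?thesis
    proof (cases "?r \<le> 1 / ?r")
      case True
      then have "min ?r (1 / ?r) = ?r" by (rule min_absorb1)
      then show ?thesis using s3 s(1) by simp
    next
      case False
      then have mn: "min ?r (1 / ?r) = 1 / ?r" by (intro min_absorb2) simp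
      note s3
      also have "3 * (\<Sum>x\<in>cube N. min (c * dir_major N x) l) \<le> 3 * (2 ^ N * K * sqrt (c * l) * (1 / ?r))"
        using s(2) by (rule mult_left_mono) simp
      also have "\<dots> = 2 ^ N * (3 * K) * sqrt (c * l) * min ?r (1 / ?r)"
        unfolding mn by simp
      finally show ?thesis .
    qed
  qed
  have phi: "(\<Sum>x\<in>cube N. min (c * fej_major N x) l) \<le> 3 * K * 2 ^ N * sqrt (c * l) * pot ((c / l) powr (1/4))"
    if "c > 0" "l > 0" for N c l
    using that
  proof (induction N arbitrary: c)
    case 0
    let ?r = "(c / l) powr (1/4)"
    have r: "?r > 0" using 0 by simp
    have "min c l \<le> sqrt (c * l) * ?r" "min c l \<le> sqrt (c * l) * (1 / ?r)"
      using min_le_powr_mult[of c l "1/4"] min_le_powr_mult[of c l "3/4"] powr_quarter[of c l] 0 by auto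
    then have "min c l \<le> sqrt (c * l) * min ?r (1 / ?r)" unfolding min_def[of ?r] by auto
    also have "\<dots> \<le> sqrt (c * l) * pot ?r"
      using pot_step[OF r] pot_nonneg[of "sqrt 2 * ?r"] r 0 by (intro mult_left_mono) auto
    also have "\<dots> \<le> 3 * K * (sqrt (c * l) * pot ?r)"
    proof -
      have "sqrt (c * l) * pot ?r \<ge> 0" using pot_nonneg[OF r] 0 by auto
      then show ?thesis using K(1) mult_right_mono[of 1 "3 * K" "sqrt (c * l) * pot ?r"] by simp
    qed
    finally show ?case using fiber_refl[of 0 "\<lambda>_. False"] by (simp add: mult_ac)
  next
    case (Suc N)
    let ?r = "(c / l) powr (1/4)"
    have r: "?r > 0" using Suc by simp
    have "(4 * c / l) powr (1/4) = 4 powr (1/4) * ?r"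
      using Suc.prems powr_mult[of 4 "c / l" "1/4"] by simp
    also have "4 powr (1/4) = (2 powr 2) powr (1/4 :: real)" by simp
    also have "\<dots> = sqrt 2" by (subst powr_powr) (simp add: powr_half_sqrt)
    finally have r4: "(4 * c / l) powr (1/4) = sqrt 2 * ?r" .
    have sq4: "sqrt (4 * c * l) = 2 * sqrt (c * l)"
      by (simp add: real_sqrt_mult)
    have "(\<Sum>x\<in>cube (Suc N). min (c * fej_major (Suc N) x) l)
        = (\<Sum>t\<in>cube N. min (c * fej_major (Suc N) t) l + min (c * fej_major (Suc N) (t(N := True))) l)"
      by (rule sum_cube_Suc)
    also have "\<dots> \<le> (\<Sum>t\<in>cube N. 2 * min (3 * c * dir_major N t) l + min (4 * c * fej_major N t) l)"
    proof (rule sum_mono)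
      fix t assume "t \<in> cube N"
      then have t: "\<not> t N" by (simp add: cube_def)
      have V: "dir_major N t \<ge> 1" "fej_major N t \<ge> 1" by (rule dir_major_ge_1, rule fej_major_ge_1)
      have cV: "c \<le> c * dir_major N t" using V Suc.prems by simp
      have "c * fej_major (Suc N) t = c * dir_major N t * 2 + c + 4 * c * fej_major N t"
        using t by (simp add: algebra_simps)
      also have "\<dots> \<le> 3 * c * dir_major N t + 4 * c * fej_major N t" using cV by simp
      finally have "min (c * fej_major (Suc N) t) l \<le> min (3 * c * dir_major N t + 4 * c * fej_major N t) l" by simp
      also have "\<dots> \<le> min (3 * c * dir_major N t) l + min (4 * c * fej_major N t) l"
        using Suc.prems V by (intro min_add_le) auto
      finally have 1: "min (c * fej_major (Suc N) t) l \<le> min (3 * c * dir_major N t) l + min (4 * c * fej_major N t) l" .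
      have "c * fej_major (Suc N) (t(N := True)) = c * dir_major N t * 2 + c"
        using depends_below_upd[OF depends_dir_major[of N], of N t True] by (simp add: algebra_simps)
      also have "\<dots> \<le> 3 * c * dir_major N t" using cV by simp
      finally have "min (c * fej_major (Suc N) (t(N := True))) l \<le> min (3 * c * dir_major N t) l" by simp
      with 1 show "min (c * fej_major (Suc N) t) l + min (c * fej_major (Suc N) (t(N := True))) l
          \<le> 2 * min (3 * c * dir_major N t) l + min (4 * c * fej_major N t) l" by linarith
    qed
    also have "\<dots> = 2 * (\<Sum>t\<in>cube N. min (3 * c * dir_major N t) l) + (\<Sum>t\<in>cube N. min (4 * c * fej_major N t) l)"
      by (simp add: sum.distrib sum_distrib_left)
    also have "\<dots> \<le> 2 * (2 ^ N * (3 * K) * sqrt (c * l) * min ?r (1 / ?r))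
        + 3 * K * 2 ^ N * sqrt (4 * c * l) * pot ((4 * c / l) powr (1/4))"
      using Suc.prems by (intro add_mono mult_left_mono psi Suc.IH) auto
    also have "\<dots> = 3 * K * 2 ^ Suc N * sqrt (c * l) * (min ?r (1 / ?r) + pot (sqrt 2 * ?r))"
      unfolding r4 sq4 by (simp add: algebra_simps)
    also have "\<dots> \<le> 3 * K * 2 ^ Suc N * sqrt (c * l) * pot ?r"
      using K Suc.prems by (intro mult_left_mono pot_step r) auto
    finally show ?case .
  qed
  obtain P where P: "P > 0" "\<And>y. y > 0 \<Longrightarrow> pot y \<le> P" using pot_bounded by blast
  show ?thesis
  proof (intro exI[of _ "3 * K * P"] conjI allI impI)
    fix N :: nat and c l :: real assume c: "c > 0" "l > 0"
    have "(\<Sum>x\<in>cube N. min (c * fej_major N x) l) \<le> 3 * K * 2 ^ N * sqrt (c * l) * pot ((c / l) powr (1/4))"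
      using c by (rule phi)
    also have "\<dots> \<le> 3 * K * 2 ^ N * sqrt (c * l) * P"
      using K c by (intro mult_left_mono P) auto
    finally show "(\<Sum>x\<in>cube N. min (c * fej_major N x) l) \<le> 3 * K * P * 2 ^ N * sqrt (c * l)"
      by (simp add: mult_ac)
  qed (use K P in auto)
qed

subsection \<open>Martingales and convolution\<close>

lemma martingale_depends: "walsh_martingale f \<Longrightarrow> depends_below n (f n)"
  by (simp add: walsh_martingale_def depends_below_def)

lemma martingale_avg:
  assumes "walsh_martingale f"
  shows "f (Suc n) (x(n := False)) + f (Suc n) (x(n := True)) = 2 * f n x"
proof -
  have "f n x = (f (Suc n) (x(n := False)) + f (Suc n) (x(n := True))) / 2"
    using assms unfolding walsh_martingale_def by blast
  then show ?thesis by simp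
qed

lemma martingale_avg_cube:
  assumes "walsh_martingale f" "t \<in> cube n"
  shows "f (Suc n) t + f (Suc n) (t(n := True)) = 2 * f n t"
proof -
  have "t(n := False) = t" using assms(2) by (intro fun_upd_idem) (simp add: cube_def)
  then show ?thesis using martingale_avg[OF assms(1), of n t] by simp
qed

lemma martingale_sum_fiber:
  assumes "walsh_martingale f" "N \<le> M"
  shows "(\<Sum>t\<in>fiber N M c. f M t) = 2 ^ (M - N) * f N c"
  using assms(2)
proof (induction M rule: dec_induct)
  case base
  then show ?case
    by (simp add: fiber_refl depends_below_trunc[OF martingale_depends[OF assms(1)]])
next
  case (step M)
  have "(\<Sum>t\<in>fiber N (Suc M) c. f (Suc M) t) = (\<Sum>t\<in>fiber N M c. f (Suc M) t + f (Suc M) (t(M := True)))"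
    using step.hyps(1) by (rule sum_fiber_Suc)
  also have "\<dots> = (\<Sum>t\<in>fiber N M c. 2 * f M t)"
    by (intro sum.cong refl martingale_avg_cube assms) (auto simp: fiber_def)
  also have "\<dots> = 2 ^ (Suc M - N) * f N c"
    using step by (simp add: sum_distrib_left[symmetric] Suc_diff_le)
  finally show ?case .
qed

lemma martingale_diff:
  assumes "walsh_martingale f" "walsh_martingale g"
  shows "walsh_martingale (\<lambda>n x. f n x - g n x)"
  unfolding walsh_martingale_def
proof (intro conjI allI impI)
  fix n :: nat and x y :: "nat \<Rightarrow> bool" assume "\<forall>j<n. x j = y j"
  then show "f n x - g n x = f n y - g n y"
    using depends_belowD[OF martingale_depends[OF assms(1)], of n x y]
      depends_belowD[OF martingale_depends[OF assms(2)], of n x y] by simp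
next
  fix n x
  show "f n x - g n x = (f (Suc n) (x(n := False)) - g (Suc n) (x(n := False))
      + (f (Suc n) (x(n := True)) - g (Suc n) (x(n := True)))) / 2"
    using martingale_avg[OF assms(1), of n x] martingale_avg[OF assms(2), of n x]
    by (simp add: field_simps)
qed

text \<open>From \<open>n = M\<close> on the integrals are constant: averaging over a coordinate
  that \<open>kaczmarz i\<close> does not see reproduces the previous level of the
  martingale.\<close>

lemma fourier_coeff_eq:
  assumes f: "walsh_martingale f" and i: "i < 2 ^ M"
  shows "fourier_coeff f i = (\<Sum>t\<in>cube M. f M t * kaczmarz i t) / 2 ^ M"
proof -
  have int: "(\<integral>x. f n x * kaczmarz i x \<partial>walsh_measure) = (\<Sum>t\<in>cube M. f M t * kaczmarz i t) / 2 ^ M"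
    if "M \<le> n" for n
    using that
  proof (induction n rule: dec_induct)
    have dep: "depends_below n (\<lambda>x. f n x * kaczmarz i x)" if "M \<le> n" for n
      unfolding depends_below_def
    proof (intro allI impI)
      fix x y :: "nat \<Rightarrow> bool" assume xy: "\<forall>j<n. x j = y j"
      have "f n x = f n y" by (rule depends_belowD[OF martingale_depends[OF f]]) (use xy in auto)
      moreover have "kaczmarz i x = kaczmarz i y"
        by (rule depends_belowD[OF depends_kaczmarz[OF i]]) (use xy that in auto)
      ultimately show "f n x * kaczmarz i x = f n y * kaczmarz i y" by simp
    qed
    {
      case base
      show ?case by (rule integral_depends_below[OF dep]) simp
    next
      case (step n)
      have k: "kaczmarz i (t(n := b)) = kaczmarz i t" for t b
        using step.hyps(1) by (rule depends_below_upd[OF depends_kaczmarz[OF i]])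
      have "(\<integral>x. f (Suc n) x * kaczmarz i x \<partial>walsh_measure)
          = (\<Sum>t\<in>cube (Suc n). f (Suc n) t * kaczmarz i t) / 2 ^ Suc n"
        using step.hyps(1) by (intro integral_depends_below dep) simp
      also have "(\<Sum>t\<in>cube (Suc n). f (Suc n) t * kaczmarz i t)
          = (\<Sum>t\<in>cube n. (f (Suc n) t + f (Suc n) (t(n := True))) * kaczmarz i t)"
        unfolding sum_cube_Suc k by (simp add: distrib_right)
      also have "\<dots> = (\<Sum>t\<in>cube n. 2 * (f n t * kaczmarz i t))"
        by (intro sum.cong refl) (simp add: martingale_avg_cube[OF f])
      also have "\<dots> / 2 ^ Suc n = (\<Sum>t\<in>cube n. f n t * kaczmarz i t) / 2 ^ n"
        by (simp add: sum_distrib_left[symmetric])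
      also have "\<dots> = (\<integral>x. f n x * kaczmarz i x \<partial>walsh_measure)"
        using step.hyps(1) by (intro integral_depends_below[symmetric] dep)
      finally show ?case using step.IH by simp
    }
  qed
  have "(\<lambda>n. \<integral>x. f n x * kaczmarz i x \<partial>walsh_measure)
      \<longlonglongrightarrow> (\<Sum>t\<in>cube M. f M t * kaczmarz i t) / 2 ^ M"
    by (rule tendsto_eventually) (use int in \<open>auto simp: eventually_sequentially\<close>)
  then show ?thesis unfolding fourier_coeff_def by (rule limI)
qed

text \<open>Convolution on the group at resolution \<open>M\<close>; every element is its own
  inverse, so \<open>x \<oplus>\<^sub>2 t\<close> stands for the difference.\<close>

definition conv :: "nat \<Rightarrow> ((nat \<Rightarrow> bool) \<Rightarrow> real) \<Rightarrow> ((nat \<Rightarrow> bool) \<Rightarrow> real) \<Rightarrow> (nat \<Rightarrow> bool) \<Rightarrow> real" where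
  "conv M h K x = (\<Sum>t\<in>cube M. h t * K (x \<oplus>\<^sub>2 t)) / 2 ^ M"

lemma conv_add_kernel: "conv M h (\<lambda>z. K z + L z) x = conv M h K x + conv M h L x"
  by (simp add: conv_def sum.distrib add_divide_distrib distrib_left)

lemma conv_scale_kernel: "conv M h (\<lambda>z. a * K z) x = a * conv M h K x"
  by (simp add: conv_def sum_distrib_left mult_ac)

lemma sum_partial_sum_eq_conv:
  assumes f: "walsh_martingale f" and n: "n \<le> 2 ^ M"
  shows "(\<Sum>k<n. partial_sum k f x) = conv M (f M) (kfejer n) x"
proof -
  have "(\<Sum>k<n. partial_sum k f x)
      = (\<Sum>k<n. \<Sum>i<k. \<Sum>t\<in>cube M. f M t * kaczmarz i (x \<oplus>\<^sub>2 t) / 2 ^ M)"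
    unfolding partial_sum_def
  proof (intro sum.cong refl)
    fix k i assume "k \<in> {..<n}" "i \<in> {..<k}"
    then have "i < 2 ^ M" using n by simp
    then show "fourier_coeff f i * kaczmarz i x = (\<Sum>t\<in>cube M. f M t * kaczmarz i (x \<oplus>\<^sub>2 t) / 2 ^ M)"
      by (simp add: fourier_coeff_eq[OF f] kaczmarz_add2 sum_divide_distrib sum_distrib_left sum_distrib_right mult_ac)
  qed
  also have "\<dots> = (\<Sum>k<n. \<Sum>t\<in>cube M. \<Sum>i<k. f M t * kaczmarz i (x \<oplus>\<^sub>2 t) / 2 ^ M)"
    by (rule sum.cong[OF refl], rule sum.swap)
  also have "\<dots> = (\<Sum>t\<in>cube M. \<Sum>k<n. \<Sum>i<k. f M t * kaczmarz i (x \<oplus>\<^sub>2 t) / 2 ^ M)"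
    by (rule sum.swap)
  also have "\<dots> = conv M (f M) (kfejer n) x"
    by (simp add: conv_def kfejer_def kdir_def sum_divide_distrib sum_distrib_left)
  finally show ?thesis .
qed

text \<open>By \<open>kdir_full\<close> this is averaging over the level \<open>i\<close> interval
  of \<open>x\<close>, that is, conditional expectation.\<close>

lemma conv_kdir:
  assumes f: "walsh_martingale f" and i: "i \<le> M"
  shows "conv M (f M) (kdir (2 ^ i)) x = f i x"
proof -
  have "(\<Sum>t\<in>cube M. f M t * kdir (2 ^ i) (x \<oplus>\<^sub>2 t))
      = (\<Sum>t\<in>cube M. if \<forall>j<i. t j = x j then 2 ^ i * f M t else 0)"
    by (intro sum.cong refl) (auto simp: kdir_full add2_def)
  also have "\<dots> = (\<Sum>t\<in>fiber i M x. 2 ^ i * f M t)"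
    unfolding fiber_def by (rule sum.inter_filter[symmetric]) simp
  also have "\<dots> = 2 ^ M * f i x"
    using i by (simp add: sum_distrib_left[symmetric] martingale_sum_fiber[OF f] power_add[symmetric])
  finally show ?thesis by (simp add: conv_def)
qed

text \<open>\<open>kfejer_add\<close> adds one dyadic block at a time. Full blocks sum geometrically
  to \<open>2 ^ A * (e + b)\<close>, and the incomplete last block costs a further
  \<open>2 ^ A * b\<close>, whence the factor 2.\<close>

lemma conv_kfejer_bound:
  assumes e: "\<And>i. i < M \<Longrightarrow> \<bar>conv M h (kdir (2 ^ i)) x\<bar> \<le> e" "e \<ge> 0"
    and b: "\<And>i m. i < M \<Longrightarrow> m \<le> 2 ^ i \<Longrightarrow>
        \<bar>conv M h (\<lambda>z. rademacher i z * revfejer i m z) x\<bar> \<le> 2 ^ i * b" "b \<ge> 0"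
    and n: "1 \<le> n" "n \<le> 2 ^ M"
  shows "\<bar>conv M h (kfejer n) x\<bar> \<le> real n * (e + 2 * b)"
proof -
  have split: "\<bar>conv M h (kfejer (2 ^ A + m)) x\<bar>
      \<le> \<bar>conv M h (kfejer (2 ^ A)) x\<bar> + real m * e + 2 ^ A * b"
    if "A < M" "m \<le> 2 ^ A" for A m
  proof -
    have "kfejer (2 ^ A + m) = (\<lambda>z. (kfejer (2 ^ A) z + real m * kdir (2 ^ A) z)
        + rademacher A z * revfejer A m z)"
      using kfejer_add[OF that(2)] by auto
    then have "conv M h (kfejer (2 ^ A + m)) x = conv M h (kfejer (2 ^ A)) x
        + real m * conv M h (kdir (2 ^ A)) x + conv M h (\<lambda>z. rademacher A z * revfejer A m z) x"
      by (simp add: conv_add_kernel conv_scale_kernel)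
    moreover have "\<bar>real m * conv M h (kdir (2 ^ A)) x\<bar> \<le> real m * e"
      unfolding abs_mult using e that by (intro mult_mono) auto
    ultimately show ?thesis using b(1)[OF that] by linarith
  qed
  have full: "\<bar>conv M h (kfejer (2 ^ A)) x\<bar> \<le> 2 ^ A * (e + b)" if "A \<le> M" for A
    using that
  proof (induction A)
    case 0
    have "kfejer (2 ^ 0) = (\<lambda>z. 0)" by (auto simp: kfejer_def kdir_def)
    then show ?case using e(2) b(2) by (simp add: conv_def)
  next
    case (Suc A)
    then have "\<bar>conv M h (kfejer (2 ^ Suc A)) x\<bar> \<le> 2 ^ A * (e + b) + 2 ^ A * e + 2 ^ A * b"
      using split[of A "2 ^ A"] by (simp add: mult_2)
    also have "\<dots> = 2 ^ Suc A * (e + b)" by (simp add: algebra_simps)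
    finally show ?case .
  qed
  obtain A m where A: "n = 2 ^ A + m" "m < 2 ^ A" using dyadic_split[OF n(1)] by auto
  have "(2::nat) ^ A \<le> 2 ^ M" using A n by linarith
  then have "A \<le> M" by simp
  have "\<bar>conv M h (kfejer n) x\<bar> \<le> 2 ^ A * (e + b) + real m * e + 2 ^ A * b"
  proof (cases "A = M")
    case True
    then have "m = 0" using A n by simp
    moreover have "0 \<le> 2 ^ M * b" using b(2) by simp
    ultimately show ?thesis using full[of A] True A by simp
  next
    case False
    then show ?thesis using \<open>A \<le> M\<close> split[of A m] full[of A] A by simp
  qed
  also have "\<dots> \<le> real n * (e + 2 * b)"
  proof -
    have "0 \<le> real m * b" using b(2) by simp
    then show ?thesis using A by (simp add: algebra_simps)
  qed
  finally show ?thesis .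
qed

text \<open>The 9 is 3/2 from \<open>abs_revfejer_le\<close> times 6 from
  \<open>sum_fej_major_le\<close>. After division by \<open>2 ^ M\<close> for the convolution and
  \<open>2 ^ i\<close> for the Fejer mean, neither \<open>i\<close> nor \<open>m\<close> remains, so
  a supremum over the index is free.\<close>

lemma fiber_kernel_bound:
  assumes h: "\<And>t. t \<in> cube M \<Longrightarrow> \<bar>h t\<bar> \<le> H" and i: "N \<le> i" "i < M" "m \<le> 2 ^ i"
  shows "\<bar>\<Sum>t\<in>fiber N M c. h t * (rademacher i (x \<oplus>\<^sub>2 t) * revfejer i m (x \<oplus>\<^sub>2 t))\<bar>
    \<le> 2 ^ M * 2 ^ i * (9 * H * (1/4) ^ N * fej_major N (x \<oplus>\<^sub>2 c))"
proof -
  have H: "H \<ge> 0" using h[of "\<lambda>_. False"] by (auto simp: cube_def intro: order_trans[OF abs_ge_zero])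
  have "\<bar>\<Sum>t\<in>fiber N M c. h t * (rademacher i (x \<oplus>\<^sub>2 t) * revfejer i m (x \<oplus>\<^sub>2 t))\<bar>
      \<le> (\<Sum>t\<in>fiber N M c. \<bar>h t * (rademacher i (x \<oplus>\<^sub>2 t) * revfejer i m (x \<oplus>\<^sub>2 t))\<bar>)"
    by (rule sum_abs)
  also have "\<dots> \<le> (\<Sum>t\<in>fiber N M c. H * (3 / 2 * fej_major i (x \<oplus>\<^sub>2 t)))"
  proof (rule sum_mono)
    fix t assume "t \<in> fiber N M c"
    then have "\<bar>h t\<bar> \<le> H" using h by (simp add: fiber_def)
    moreover have "\<bar>rademacher i (x \<oplus>\<^sub>2 t) * revfejer i m (x \<oplus>\<^sub>2 t)\<bar> \<le> 3 / 2 * fej_major i (x \<oplus>\<^sub>2 t)"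
      using abs_revfejer_le[OF i(3), of "x \<oplus>\<^sub>2 t"] by (simp add: abs_mult rademacher_def)
    ultimately show "\<bar>h t * (rademacher i (x \<oplus>\<^sub>2 t) * revfejer i m (x \<oplus>\<^sub>2 t))\<bar>
        \<le> H * (3 / 2 * fej_major i (x \<oplus>\<^sub>2 t))"
      using H by (subst abs_mult) (rule mult_mono, auto)
  qed
  also have "\<dots> = H * (3 / 2) * (\<Sum>t\<in>fiber N M c. fej_major i (x \<oplus>\<^sub>2 t))"
    by (simp add: sum_distrib_left mult_ac)
  also have "(\<Sum>t\<in>fiber N M c. fej_major i (x \<oplus>\<^sub>2 t)) = 2 ^ (M - i) * (\<Sum>t\<in>fiber N i c. fej_major i (x \<oplus>\<^sub>2 t))"
    using i by (intro sum_fiber_depends depends_below_add2 depends_fej_major) auto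
  also have "H * (3 / 2) * (2 ^ (M - i) * (\<Sum>t\<in>fiber N i c. fej_major i (x \<oplus>\<^sub>2 t)))
      \<le> H * (3 / 2) * (2 ^ (M - i) * (6 * 4 ^ (i - N) * fej_major N (x \<oplus>\<^sub>2 c)))"
    using H i by (intro mult_left_mono sum_fej_major_le) auto
  also have "\<dots> = (2 ^ (M - i) * 4 ^ (i - N)) * (9 * H * fej_major N (x \<oplus>\<^sub>2 c))"
    by (simp add: algebra_simps)
  also have "(2::real) ^ (M - i) * 4 ^ (i - N) = 2 ^ M * 2 ^ i * (1/4) ^ N"
  proof -
    have "(4::real) ^ i = 2 ^ i * 2 ^ i" by (simp flip: power_mult_distrib)
    then show ?thesis using i by (simp add: power_diff power_one_over field_simps)
  qed
  finally show ?thesis by (simp add: mult_ac)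
qed

lemma sum_stopping:
  fixes \<phi> :: "_ \<Rightarrow> real"
  assumes dep: "\<And>N. depends_below N (st N)"
    and uniq: "\<And>N N' t. st N t \<Longrightarrow> st N' t \<Longrightarrow> N = N'"
  shows "(\<Sum>t\<in>cube M. if \<exists>N<M. st N t then \<phi> t else 0)
    = (\<Sum>N<M. \<Sum>c\<in>{c \<in> cube N. st N c}. \<Sum>t\<in>fiber N M c. \<phi> t)"
proof -
  have "(\<Sum>t\<in>cube M. if \<exists>N<M. st N t then \<phi> t else 0)
      = (\<Sum>t\<in>cube M. \<Sum>N<M. if st N t then \<phi> t else 0)"
  proof (intro sum.cong refl)
    fix t
    show "(if \<exists>N<M. st N t then \<phi> t else 0) = (\<Sum>N<M. if st N t then \<phi> t else 0)"
    proof (cases "\<exists>N<M. st N t")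
      case True
      then obtain N where N: "N < M" "st N t" by blast
      have "(\<Sum>K<M. if st K t then \<phi> t else 0) = (\<Sum>K<M. if K = N then \<phi> t else 0)"
        by (intro sum.cong refl) (use N uniq in auto)
      then show ?thesis using N True by simp
    next
      case False
      then have "(\<Sum>N<M. if st N t then \<phi> t else 0) = 0" by (intro sum.neutral) auto
      then show ?thesis using False by auto
    qed
  qed
  also have "\<dots> = (\<Sum>N<M. \<Sum>t\<in>cube M. if st N t then \<phi> t else 0)"
    by (rule sum.swap)
  also have "\<dots> = (\<Sum>N<M. \<Sum>c\<in>cube N. if st N c then \<Sum>t\<in>fiber N M c. \<phi> t else 0)"
  proof (rule sum.cong[OF refl])
    fix N assume "N \<in> {..<M}"
    then have "(\<Sum>t\<in>cube M. if st N t then \<phi> t else 0)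
        = (\<Sum>c\<in>cube N. \<Sum>t\<in>fiber N M c. if st N t then \<phi> t else 0)"
      by (intro sum_cube_fiber) simp
    also have "\<dots> = (\<Sum>c\<in>cube N. if st N c then \<Sum>t\<in>fiber N M c. \<phi> t else 0)"
    proof (rule sum.cong[OF refl])
      fix c
      have "st N t = st N c" if "t \<in> fiber N M c" for t
        by (rule depends_belowD[OF dep]) (use that in \<open>auto simp: fiber_def\<close>)
      then show "(\<Sum>t\<in>fiber N M c. if st N t then \<phi> t else 0) = (if st N c then \<Sum>t\<in>fiber N M c. \<phi> t else 0)"
        by (auto intro!: sum.neutral sum.cong)
    qed
    finally show "(\<Sum>t\<in>cube M. if st N t then \<phi> t else 0)
        = (\<Sum>c\<in>cube N. if st N c then \<Sum>t\<in>fiber N M c. \<phi> t else 0)" .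
  qed
  also have "\<dots> = (\<Sum>N<M. \<Sum>c\<in>{c \<in> cube N. st N c}. \<Sum>t\<in>fiber N M c. \<phi> t)"
    by (rule sum.cong[OF refl], rule sum.inter_filter[symmetric]) simp
  finally show ?thesis .
qed

text \<open>On a stopping interval of level \<open>N > i\<close> the kernel is constant, and the
  zero mean of the piece annihilates it; for \<open>N \<le> i\<close> the size bound of
  \<open>fiber_kernel_bound\<close> applies.\<close>

lemma conv_stopping_bound:
  assumes B: "walsh_martingale B" and H: "\<And>t. t \<in> cube M \<Longrightarrow> \<bar>B M t\<bar> \<le> H"
    and dep: "\<And>N. depends_below N (st N)"
    and uniq: "\<And>N N' t. st N t \<Longrightarrow> st N' t \<Longrightarrow> N = N'"
    and supp: "\<And>t. t \<in> cube M \<Longrightarrow> B M t \<noteq> 0 \<Longrightarrow> \<exists>N<M. st N t"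
    and mean0: "\<And>N c. st N c \<Longrightarrow> B N c = 0"
    and i: "i < M" "m \<le> 2 ^ i"
  shows "\<bar>conv M (B M) (\<lambda>z. rademacher i z * revfejer i m z) x\<bar>
    \<le> 2 ^ i * (\<Sum>N<M. \<Sum>c\<in>{c \<in> cube N. st N c}. 9 * H * (1/4) ^ N * fej_major N (x \<oplus>\<^sub>2 c))"
proof -
  let ?K = "\<lambda>z. rademacher i z * revfejer i m z"
  have H0: "H \<ge> 0" using H[of "\<lambda>_. False"] by (auto simp: cube_def intro: order_trans[OF abs_ge_zero])
  have depK: "depends_below (Suc i) ?K"
    unfolding depends_below_def
  proof (intro allI impI)
    fix z y :: "nat \<Rightarrow> bool" assume zy: "\<forall>j<Suc i. z j = y j"
    have "revwalsh i k z = revwalsh i k y" for k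
      by (rule depends_belowD[OF depends_revwalsh]) (use zy in auto)
    then show "?K z = ?K y" using zy by (simp add: revfejer_def revdir_def rademacher_def)
  qed
  have each: "\<bar>\<Sum>t\<in>fiber N M c. B M t * ?K (x \<oplus>\<^sub>2 t)\<bar>
      \<le> 2 ^ M * 2 ^ i * (9 * H * (1/4) ^ N * fej_major N (x \<oplus>\<^sub>2 c))" if "N < M" "st N c" for N c
  proof (cases "N \<le> i")
    case True
    then show ?thesis using H i by (intro fiber_kernel_bound) auto
  next
    case False
    have "?K (x \<oplus>\<^sub>2 t) = ?K (x \<oplus>\<^sub>2 c)" if "t \<in> fiber N M c" for t
      by (rule depends_belowD[OF depK]) (use that False in \<open>auto simp: fiber_def add2_def\<close>)
    then have "(\<Sum>t\<in>fiber N M c. B M t * ?K (x \<oplus>\<^sub>2 t)) = (\<Sum>t\<in>fiber N M c. B M t) * ?K (x \<oplus>\<^sub>2 c)"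
      unfolding sum_distrib_right by (intro sum.cong refl) simp
    also have "\<dots> = 0" using that by (simp add: martingale_sum_fiber[OF B] mean0)
    finally show ?thesis using H0 fej_major_ge_1[of N "x \<oplus>\<^sub>2 c"] by simp
  qed
  have "(\<Sum>t\<in>cube M. B M t * ?K (x \<oplus>\<^sub>2 t))
      = (\<Sum>t\<in>cube M. if \<exists>N<M. st N t then B M t * ?K (x \<oplus>\<^sub>2 t) else 0)"
    using supp by (intro sum.cong refl) auto
  also have "\<dots> = (\<Sum>N<M. \<Sum>c\<in>{c \<in> cube N. st N c}. \<Sum>t\<in>fiber N M c. B M t * ?K (x \<oplus>\<^sub>2 t))"
    using dep uniq by (rule sum_stopping)
  also have "\<bar>\<dots>\<bar> \<le> (\<Sum>N<M. \<Sum>c\<in>{c \<in> cube N. st N c}.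
      2 ^ M * 2 ^ i * (9 * H * (1/4) ^ N * fej_major N (x \<oplus>\<^sub>2 c)))"
    by (intro order_trans[OF sum_abs] sum_mono each) auto
  also have "\<dots> = 2 ^ M * (2 ^ i * (\<Sum>N<M. \<Sum>c\<in>{c \<in> cube N. st N c}.
      9 * H * (1/4) ^ N * fej_major N (x \<oplus>\<^sub>2 c)))"
    by (simp add: sum_distrib_left mult_ac)
  finally show ?thesis by (simp add: conv_def divide_le_eq mult_ac)
qed

subsection \<open>Stopping and the decomposition at a fixed level\<close>

text \<open>
  \<open>child_abs f n\<close> dominates \<open>f (Suc n)\<close> but depends on \<open>n\<close> coordinates only, so stopping before it
  exceeds \<open>\<theta>\<close> keeps the stopped martingale bounded by \<open>\<theta>\<close>.
\<close>

definition child_abs :: "(nat \<Rightarrow> (nat \<Rightarrow> bool) \<Rightarrow> real) \<Rightarrow> nat \<Rightarrow> (nat \<Rightarrow> bool) \<Rightarrow> real" where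
  "child_abs f n x = \<bar>f (Suc n) (x(n := True))\<bar> + \<bar>f (Suc n) (x(n := False))\<bar>"

primrec stopped :: "(nat \<Rightarrow> (nat \<Rightarrow> bool) \<Rightarrow> real) \<Rightarrow> real \<Rightarrow> nat \<Rightarrow> (nat \<Rightarrow> bool) \<Rightarrow> real" where
  "stopped f \<theta> 0 x = f 0 x"
| "stopped f \<theta> (Suc n) x = stopped f \<theta> n x
    + (if \<forall>i\<le>n. child_abs f i x \<le> \<theta> then f (Suc n) x - f n x else 0)"

lemma depends_child_abs:
  assumes f: "walsh_martingale f"
  shows "depends_below n (child_abs f n)"
  unfolding depends_below_def
proof (intro allI impI)
  fix x y :: "nat \<Rightarrow> bool" assume xy: "\<forall>j<n. x j = y j"
  have "f (Suc n) (x(n := b)) = f (Suc n) (y(n := b))" for b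
    by (rule depends_belowD[OF martingale_depends[OF f]]) (use xy in \<open>auto simp: less_Suc_eq\<close>)
  then show "child_abs f n x = child_abs f n y" by (simp add: child_abs_def)
qed

lemma abs_Suc_le_child_abs: "\<bar>f (Suc n) x\<bar> \<le> child_abs f n x"
proof -
  have "x = x(n := x n)" by simp
  then show ?thesis unfolding child_abs_def
    by (cases "x n") (metis abs_ge_zero add_increasing2 order_refl, metis abs_ge_zero add_increasing order_refl)
qed

lemma abs_le_child_abs:
  assumes "walsh_martingale f"
  shows "\<bar>f n x\<bar> \<le> child_abs f n x"
  using martingale_avg[OF assms, of n x] unfolding child_abs_def by linarith

text \<open>The value at the sibling is \<open>2 * f n x - f (Suc n) x\<close>, so looking one step
  ahead costs only a factor 4 against the maximal function.\<close>

lemma child_abs_le: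
  assumes "walsh_martingale f"
  shows "child_abs f n x \<le> 2 * \<bar>f n x\<bar> + 2 * \<bar>f (Suc n) x\<bar>"
proof (cases "x n")
  case True
  then have "x(n := True) = x" by (intro fun_upd_idem) simp
  then show ?thesis using martingale_avg[OF assms, of n x] unfolding child_abs_def by simp
next
  case False
  then have "x(n := False) = x" by (intro fun_upd_idem) simp
  then show ?thesis using martingale_avg[OF assms, of n x] unfolding child_abs_def by simp
qed

text \<open>Whether the increment from \<open>n\<close> to \<open>Suc n\<close> is kept is decided
  by the first \<open>n\<close> coordinates: a martingale transform with a predictable
  factor.\<close>

lemma walsh_martingale_stopped:
  assumes f: "walsh_martingale f"
  shows "walsh_martingale (stopped f \<theta>)"
proof -
  have ca: "child_abs f i x = child_abs f i y" if "i \<le> n" "\<forall>j<n. x j = y j" for i n x y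
    by (rule depends_belowD[OF depends_child_abs[OF f]]) (use that in auto)
  have dep: "depends_below n (stopped f \<theta> n)" for n
  proof (induction n)
    case 0
    show ?case using martingale_depends[OF f, of 0] by (simp add: depends_below_def)
  next
    case (Suc n)
    show ?case
      unfolding depends_below_def
    proof (intro allI impI)
      fix x y :: "nat \<Rightarrow> bool" assume xy: "\<forall>j<Suc n. x j = y j"
      have "stopped f \<theta> n x = stopped f \<theta> n y"
        by (rule depends_belowD[OF Suc]) (use xy in auto)
      moreover have "f n x = f n y" "f (Suc n) x = f (Suc n) y"
        by (rule depends_belowD[OF martingale_depends[OF f]], use xy in auto)+
      moreover have "(\<forall>i\<le>n. child_abs f i x \<le> \<theta>) \<longleftrightarrow> (\<forall>i\<le>n. child_abs f i y \<le> \<theta>)"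
        using ca[of _ n x y] xy by auto
      ultimately show "stopped f \<theta> (Suc n) x = stopped f \<theta> (Suc n) y"
        by (simp only: stopped.simps)
    qed
  qed
  have "stopped f \<theta> n x
      = (stopped f \<theta> (Suc n) (x(n := False)) + stopped f \<theta> (Suc n) (x(n := True))) / 2" for n x
  proof -
    have "stopped f \<theta> n (x(n := b)) = stopped f \<theta> n x" for b
      by (rule depends_below_upd[OF dep]) simp
    moreover have "f n (x(n := b)) = f n x" for b
      by (rule depends_below_upd[OF martingale_depends[OF f]]) simp
    moreover have "(\<forall>i\<le>n. child_abs f i (x(n := b)) \<le> \<theta>) \<longleftrightarrow> (\<forall>i\<le>n. child_abs f i x \<le> \<theta>)" for b
      using ca[of _ n "x(n := b)" x] by auto
    ultimately have "stopped f \<theta> (Suc n) (x(n := b)) = stopped f \<theta> n x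
        + (if \<forall>i\<le>n. child_abs f i x \<le> \<theta> then f (Suc n) (x(n := b)) - f n x else 0)" for b
      by (simp only: stopped.simps)
    then show ?thesis using martingale_avg[OF f, of n x]
      by (cases "\<forall>i\<le>n. child_abs f i x \<le> \<theta>") (simp_all only: if_True if_False, simp_all)
  qed
  then show ?thesis
    using dep unfolding walsh_martingale_def depends_below_def by blast
qed

lemma stopped_eq: "(\<And>i. i < n \<Longrightarrow> child_abs f i x \<le> \<theta>) \<Longrightarrow> stopped f \<theta> n x = f n x"
proof (induction n)
  case (Suc n)
  then have "stopped f \<theta> n x = f n x" by simp
  then show ?case using Suc.prems by simp
qed simp

text \<open>The last increment kept leads to a value dominated by a \<open>child_abs\<close> that
  passed the test. Stopping cannot affect the initial value \<open>f 0\<close>, which is controlled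
  by the hypothesis at level 0.\<close>

lemma stopped_bound:
  assumes "walsh_martingale f" "child_abs f 0 x \<le> \<theta>"
  shows "\<bar>stopped f \<theta> n x\<bar> \<le> \<theta>"
proof (induction n)
  case 0
  show ?case using abs_le_child_abs[OF assms(1), of 0 x] assms(2) by simp
next
  case (Suc n)
  show ?case
  proof (cases "\<forall>i\<le>n. child_abs f i x \<le> \<theta>")
    case True
    then have "stopped f \<theta> (Suc n) x = f (Suc n) x" by (intro stopped_eq) auto
    then show ?thesis using abs_Suc_le_child_abs[of f n x] True by (auto intro: order_trans)
  next
    case False
    then have "stopped f \<theta> (Suc n) x = stopped f \<theta> n x" by (simp only: stopped.simps if_False add_0_right)
    then show ?thesis using Suc by simp
  qed
qed

lemma conv_sum: "conv M (\<lambda>t. g t + (\<Sum>k\<in>A. h k t)) K x = conv M g K x + (\<Sum>k\<in>A. conv M (h k) K x)"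
proof -
  have "(\<Sum>t\<in>cube M. (g t + (\<Sum>k\<in>A. h k t)) * K (x \<oplus>\<^sub>2 t))
      = (\<Sum>t\<in>cube M. g t * K (x \<oplus>\<^sub>2 t)) + (\<Sum>k\<in>A. \<Sum>t\<in>cube M. h k t * K (x \<oplus>\<^sub>2 t))"
    by (subst sum.swap) (simp add: distrib_right sum.distrib sum_distrib_right)
  then show ?thesis by (simp add: conv_def add_divide_distrib sum_divide_distrib)
qed

text \<open>The geometric sum is comparable to its last term, which is at most
  \<open>sqrt y\<close>; the 4 exceeds \<open>sqrt 2 / (sqrt 2 - 1)\<close>.\<close>

lemma sum_sqrt2_power_le:
  assumes "y \<ge> 0"
  shows "(\<Sum>k<L. if 2 ^ k < y then sqrt 2 ^ k else 0) \<le> 4 * sqrt y"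
proof (induction L)
  case (Suc L)
  show ?case
  proof (cases "2 ^ L < y")
    case True
    have s: "sqrt 2 - 1 > (0::real)" by simp
    have s2: "sqrt 2 * sqrt 2 = (2::real)" by simp
    have "(\<Sum>k<Suc L. if 2 ^ k < y then sqrt 2 ^ k else 0) \<le> (\<Sum>k<Suc L. sqrt 2 ^ k :: real)"
      by (intro sum_mono) auto
    also have "\<dots> = (sqrt 2 ^ Suc L - 1) / (sqrt 2 - 1)"
      by (subst geometric_sum) auto
    also have "\<dots> \<le> sqrt 2 ^ Suc L / (sqrt 2 - 1)"
      using s by (intro divide_right_mono) auto
    also have "\<dots> \<le> 4 * sqrt 2 ^ L"
    proof -
      have "sqrt 2 \<le> 4 * (sqrt 2 - 1 :: real)"
        using real_le_rsqrt[of "4/3" 2] by (simp add: power2_eq_square)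
      then have "sqrt 2 * sqrt 2 ^ L \<le> 4 * (sqrt 2 - 1) * sqrt 2 ^ L"
        by (intro mult_right_mono) auto
      then show ?thesis using s by (simp add: divide_le_eq mult_ac)
    qed
    also have "sqrt 2 ^ L = sqrt (2 ^ L)" by (simp add: real_sqrt_power)
    also have "4 * sqrt (2 ^ L) \<le> 4 * sqrt y" using True by simp
    finally show ?thesis .
  next
    case False
    then show ?thesis using Suc by simp
  qed
qed (use assms in simp)

lemma depends_first_exceed:
  assumes "walsh_martingale f"
  shows "depends_below N (\<lambda>c. child_abs f N c > \<theta> \<and> (\<forall>i<N. child_abs f i c \<le> \<theta>))"
  unfolding depends_below_def
proof (intro allI impI)
  fix x y :: "nat \<Rightarrow> bool" assume xy: "\<forall>j<N. x j = y j"
  have "child_abs f i x = child_abs f i y" if "i \<le> N" for i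
    by (rule depends_belowD[OF depends_child_abs[OF assms]]) (use xy that in auto)
  then show "(child_abs f N x > \<theta> \<and> (\<forall>i<N. child_abs f i x \<le> \<theta>))
      = (child_abs f N y > \<theta> \<and> (\<forall>i<N. child_abs f i y \<le> \<theta>))" by auto
qed

lemma first_exceed_iff:
  "(\<exists>N<M. child_abs f N x > \<theta> \<and> (\<forall>i<N. child_abs f i x \<le> \<theta>)) \<longleftrightarrow> (\<exists>N<M. child_abs f N x > \<theta>)"
proof
  assume "\<exists>N<M. child_abs f N x > \<theta>"
  then obtain N where N: "N < M" "child_abs f N x > \<theta>" by blast
  let ?L = "LEAST N. child_abs f N x > \<theta>"
  have "child_abs f ?L x > \<theta>" using N(2) by (rule LeastI)
  moreover have "?L \<le> N" using N(2) by (rule Least_le)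
  moreover have "child_abs f i x \<le> \<theta>" if "i < ?L" for i using not_less_Least[OF that] by simp
  ultimately show "\<exists>N<M. child_abs f N x > \<theta> \<and> (\<forall>i<N. child_abs f i x \<le> \<theta>)"
    using N(1) by (intro exI[of _ ?L]) auto
qed blast

text \<open>Representatives of the stopping intervals of level \<open>N\<close>, as in a
  Calderon-Zygmund decomposition. Over all \<open>N < M\<close> they are disjoint, and their union
  is \<open>exceed\<close> at resolution \<open>M\<close>.\<close>

definition exceed_intervals where
  "exceed_intervals f \<theta> N = {c \<in> cube N. child_abs f N c > \<theta> \<and> (\<forall>i<N. child_abs f i c \<le> \<theta>)}"

definition exceed where
  "exceed M f \<theta> = {x \<in> cube M. \<exists>N<M. child_abs f N x > \<theta>}"

lemma finite_exceed [simp]: "finite (exceed M f \<theta>)" "finite (exceed_intervals f \<theta> N)"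
  by (simp_all add: exceed_def exceed_intervals_def)

lemma card_exceed:
  assumes "walsh_martingale f"
  shows "(\<Sum>N<M. \<Sum>c\<in>exceed_intervals f \<theta> N. 2 ^ M * (1/2) ^ N) = real (card (exceed M f \<theta>))"
proof -
  let ?st = "\<lambda>N c. child_abs f N c > \<theta> \<and> (\<forall>i<N. child_abs f i c \<le> \<theta>)"
  have "real (card (exceed M f \<theta>)) = (\<Sum>t\<in>cube M. if \<exists>N<M. ?st N t then 1 else 0)"
    unfolding first_exceed_iff by (simp add: exceed_def sum.inter_filter[symmetric])
  also have "\<dots> = (\<Sum>N<M. \<Sum>c\<in>{c \<in> cube N. ?st N c}. \<Sum>t\<in>fiber N M c. 1)"
    by (rule sum_stopping[OF depends_first_exceed[OF assms]]) (metis linorder_neqE_nat not_less)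
  also have "\<dots> = (\<Sum>N<M. \<Sum>c\<in>exceed_intervals f \<theta> N. 2 ^ M * (1/2) ^ N)"
    unfolding exceed_intervals_def
  proof (intro sum.cong refl)
    fix N c assume N: "N \<in> {..<M}"
    have "(\<Sum>t\<in>fiber N M c. 1 :: real) = 2 ^ (M - N)" using N by (simp add: card_fiber)
    also have "\<dots> = 2 ^ M * (1/2) ^ N" using N by (simp add: power_diff power_one_over)
    finally show "(\<Sum>t\<in>fiber N M c. 1 :: real) = 2 ^ M * (1/2) ^ N" .
  qed
  finally show ?thesis by simp
qed

text \<open>54 = 2 * 9 * 3: the 2 of \<open>conv_kfejer_bound\<close>, the 9 of
  \<open>fiber_kernel_bound\<close>, and 3 because the martingales stopped at
  \<open>\<theta> * 2 ^ Suc k\<close> and \<open>\<theta> * 2 ^ k\<close> differ by at most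
  \<open>3 * (\<theta> * 2 ^ k)\<close>.\<close>

definition atoms_bound where
  "atoms_bound M f \<theta> L x = (\<Sum>k<L. \<Sum>N<M. \<Sum>c\<in>exceed_intervals f (\<theta> * 2 ^ k) N.
      54 * (\<theta> * 2 ^ k) * (1/4) ^ N * fej_major N (x \<oplus>\<^sub>2 c))"

text \<open>Off \<open>exceed\<close> the pieces \<open>B k\<close> vanish at \<open>x\<close> at
  all levels up to \<open>M\<close>, so their dyadic partial sums drop out and only kernel majorants
  remain. The 19 is 1 + 2 * 9, from the conditional expectations and the kernel part of the bounded
  martingale \<open>S 0\<close>. The condition on \<open>L\<close> makes the last stopped martingale
  agree with \<open>f M\<close> on the cube.\<close>

lemma atoms_pointwise:
  assumes f: "walsh_martingale f" and M: "M \<ge> 1" and \<theta>: "\<theta> > 0"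
    and x: "x \<in> cube M" "x \<notin> exceed M f \<theta>"
    and L: "\<And>t n. t \<in> cube M \<Longrightarrow> n < M \<Longrightarrow> child_abs f n t \<le> \<theta> * 2 ^ L"
    and n: "1 \<le> n" "n \<le> 2 ^ M"
  shows "\<bar>\<Sum>k<n. partial_sum k f x\<bar> \<le> real n * (19 * \<theta> + atoms_bound M f \<theta> L x)"
proof -
  define S where "S k = stopped f (\<theta> * 2 ^ k)" for k :: nat
  define B where "B k n t = S (Suc k) n t - S k n t" for k n t
  have mS: "walsh_martingale (S k)" for k unfolding S_def using f by (rule walsh_martingale_stopped)
  have mB: "walsh_martingale (B k)" for k unfolding B_def[abs_def] by (intro martingale_diff mS)
  have up: "\<theta> \<le> \<theta> * 2 ^ k" for k using \<theta> by simp
  have xle: "child_abs f N x \<le> \<theta>" if "N < M" for N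
  proof (rule ccontr)
    assume "\<not> child_abs f N x \<le> \<theta>"
    then have "\<exists>N<M. child_abs f N x > \<theta>" using that not_le by blast
    then have "x \<in> exceed M f \<theta>" unfolding exceed_def using x(1) by simp
    with x(2) show False by simp
  qed
  \<comment> \<open>\<open>child_abs f 0\<close> depends on no coordinate, so a single point outside
    \<open>exceed\<close> bounds it everywhere; this is where \<open>M \<ge> 1\<close>
    enters.\<close>
  have ca0: "child_abs f 0 t \<le> \<theta>" for t
  proof -
    have "child_abs f 0 t = child_abs f 0 x"
      by (rule depends_belowD[OF depends_child_abs[OF f]]) simp
    then show ?thesis using xle[of 0] M by simp
  qed
  have bS: "\<bar>S k m t\<bar> \<le> \<theta> * 2 ^ k" for k m t
    unfolding S_def using order_trans[OF ca0 up] by (intro stopped_bound f)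
  have Bx: "B k m x = 0" if "m \<le> M" for k m
  proof -
    have "child_abs f i x \<le> \<theta> * 2 ^ j" if "i < m" for i j
    proof (rule order_trans[OF _ up])
      have "i < M" using that \<open>m \<le> M\<close> by simp
      then show "child_abs f i x \<le> \<theta>" by (rule xle)
    qed
    then have "S j m x = f m x" for j unfolding S_def by (intro stopped_eq) auto
    then show ?thesis by (simp add: B_def)
  qed
  have dec: "f M t = S 0 M t + (\<Sum>k<L. B k M t)" if "t \<in> cube M" for t
  proof -
    have "S L M t = f M t" unfolding S_def using L that by (intro stopped_eq) auto
    moreover have "(\<Sum>k<L. B k M t) = S L M t - S 0 M t"
      unfolding B_def by (rule sum_lessThan_telescope)
    ultimately show ?thesis by simp
  qed
  have "(\<Sum>k<n. partial_sum k f x) = conv M (f M) (kfejer n) x"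
    using f n(2) by (rule sum_partial_sum_eq_conv)
  also have "\<dots> = conv M (\<lambda>t. S 0 M t + (\<Sum>k<L. B k M t)) (kfejer n) x"
    unfolding conv_def using dec by simp
  also have "\<dots> = conv M (S 0 M) (kfejer n) x + (\<Sum>k<L. conv M (B k M) (kfejer n) x)"
    by (rule conv_sum)
  finally have eq: "(\<Sum>k<n. partial_sum k f x)
      = conv M (S 0 M) (kfejer n) x + (\<Sum>k<L. conv M (B k M) (kfejer n) x)" .
  have g: "\<bar>conv M (S 0 M) (kfejer n) x\<bar> \<le> real n * (\<theta> + 2 * (9 * \<theta>))"
  proof (rule conv_kfejer_bound)
    fix i m :: nat assume i: "i < M"
    show "\<bar>conv M (S 0 M) (kdir (2 ^ i)) x\<bar> \<le> \<theta>"
      using i bS[of 0 i x] by (simp add: conv_kdir[OF mS])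
    assume m: "m \<le> 2 ^ i"
    \<comment> \<open>The whole cube is treated as one interval of level 0, where
      \<open>fej_major\<close> is 1.\<close>
    have "\<bar>\<Sum>t\<in>fiber 0 M x. S 0 M t * (rademacher i (x \<oplus>\<^sub>2 t) * revfejer i m (x \<oplus>\<^sub>2 t))\<bar>
        \<le> 2 ^ M * 2 ^ i * (9 * \<theta> * (1/4) ^ 0 * fej_major 0 (x \<oplus>\<^sub>2 x))"
      using i m bS[of 0 M] by (intro fiber_kernel_bound) auto
    then show "\<bar>conv M (S 0 M) (\<lambda>z. rademacher i z * revfejer i m z) x\<bar> \<le> 2 ^ i * (9 * \<theta>)"
      by (simp add: conv_def divide_le_eq mult_ac)
  qed (use \<theta> n in auto)
  define Y where "Y k = (\<Sum>N<M. \<Sum>c\<in>exceed_intervals f (\<theta> * 2 ^ k) N.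
      9 * (3 * (\<theta> * 2 ^ k)) * (1/4) ^ N * fej_major N (x \<oplus>\<^sub>2 c))" for k :: nat
  have b: "\<bar>conv M (B k M) (kfejer n) x\<bar> \<le> real n * (0 + 2 * Y k)" for k
  proof (rule conv_kfejer_bound)
    fix i m :: nat assume i: "i < M"
    show "\<bar>conv M (B k M) (kdir (2 ^ i)) x\<bar> \<le> 0"
      using i by (simp add: conv_kdir[OF mB] Bx)
    assume m: "m \<le> 2 ^ i"
    show "\<bar>conv M (B k M) (\<lambda>z. rademacher i z * revfejer i m z) x\<bar> \<le> 2 ^ i * Y k"
      unfolding Y_def exceed_intervals_def
    proof (rule conv_stopping_bound[OF mB])
      fix t
      show "\<bar>B k M t\<bar> \<le> 3 * (\<theta> * 2 ^ k)"
        using bS[of "Suc k" M t] bS[of k M t] unfolding B_def by (simp add: abs_le_iff)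
    next
      fix N N' t
      assume "\<theta> * 2 ^ k < child_abs f N t \<and> (\<forall>i<N. child_abs f i t \<le> \<theta> * 2 ^ k)"
        "\<theta> * 2 ^ k < child_abs f N' t \<and> (\<forall>i<N'. child_abs f i t \<le> \<theta> * 2 ^ k)"
      then show "N = N'" by (metis linorder_neqE_nat not_less)
    next
      have k1: "\<theta> * 2 ^ k \<le> \<theta> * 2 ^ Suc k" using \<theta> by simp
      {
        fix t assume "t \<in> cube M" "B k M t \<noteq> 0"
        show "\<exists>N<M. child_abs f N t > \<theta> * 2 ^ k \<and> (\<forall>i<N. child_abs f i t \<le> \<theta> * 2 ^ k)"
        proof (rule ccontr)
          assume "\<not> ?thesis"
          then have le: "child_abs f N t \<le> \<theta> * 2 ^ k" if "N < M" for N
            using that unfolding first_exceed_iff by auto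
          then have "S k M t = f M t" "S (Suc k) M t = f M t"
            unfolding S_def using order_trans[OF le k1] by (intro stopped_eq; blast)+
          then show False using \<open>B k M t \<noteq> 0\<close> by (simp add: B_def)
        qed
      next
        fix N c assume "child_abs f N c > \<theta> * 2 ^ k \<and> (\<forall>i<N. child_abs f i c \<le> \<theta> * 2 ^ k)"
        then have le: "child_abs f i c \<le> \<theta> * 2 ^ k" if "i < N" for i using that by blast
        then have "S k N c = f N c" "S (Suc k) N c = f N c"
          unfolding S_def using order_trans[OF le k1] by (intro stopped_eq; blast)+
        then show "B k N c = 0" by (simp add: B_def)
      }
    qed (use i m depends_first_exceed[OF f] in auto)
  next
    have "0 \<le> fej_major N z" for N z using fej_major_ge_1[of N z] by linarith
    then show "0 \<le> Y k" unfolding Y_def using \<theta> by (intro sum_nonneg mult_nonneg_nonneg) auto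
  qed (use n in auto)
  have "\<bar>\<Sum>k<n. partial_sum k f x\<bar> \<le> real n * (\<theta> + 2 * (9 * \<theta>)) + (\<Sum>k<L. real n * (0 + 2 * Y k))"
    unfolding eq
    by (intro order_trans[OF abs_triangle_ineq] add_mono g order_trans[OF sum_abs] sum_mono b)
  also have "\<dots> = real n * (19 * \<theta> + (\<Sum>k<L. 2 * Y k))"
    by (simp add: sum_distrib_left algebra_simps)
  also have "(\<Sum>k<L. 2 * Y k) = atoms_bound M f \<theta> L x"
    unfolding Y_def atoms_bound_def by (intro sum.cong refl) (simp add: sum_distrib_left mult_ac)
  finally show ?thesis .
qed

subsection \<open>Weak type on finite cubes\<close>

definition finite_max :: "nat \<Rightarrow> (nat \<Rightarrow> (nat \<Rightarrow> bool) \<Rightarrow> real) \<Rightarrow> (nat \<Rightarrow> bool) \<Rightarrow> real" where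
  "finite_max M f x = Max ((\<lambda>n. \<bar>f n x\<bar>) ` {..M})"

lemma finite_max_ge: "n \<le> M \<Longrightarrow> \<bar>f n x\<bar> \<le> finite_max M f x"
  unfolding finite_max_def by (rule Max_ge) auto

lemma finite_max_nonneg: "0 \<le> finite_max M f x"
  using finite_max_ge[of 0 M f x] by (meson abs_ge_zero order_trans zero_le)

text \<open>A translation moves the interval to the origin, and \<open>sum_min_fej_major\<close>
  takes a square root: \<open>(1/4) ^ N\<close> becomes the measure of the interval and
  \<open>2 ^ k\<close> becomes \<open>sqrt 2 ^ k\<close>. The 33 rounds up the root of 54 * 19 =
  1026.\<close>

lemma sum_min_atom:
  assumes D: "D > 0" "\<forall>N c l. c > 0 \<longrightarrow> l > 0 \<longrightarrow>
      (\<Sum>x\<in>cube N. min (c * fej_major N x) l) \<le> D * 2 ^ N * sqrt (c * l)"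
    and c: "c \<in> cube N" and N: "N \<le> M" and \<theta>: "\<theta> > 0"
  shows "(\<Sum>x\<in>cube M. min (54 * (\<theta> * 2 ^ k) * (1/4) ^ N * fej_major N (x \<oplus>\<^sub>2 c)) (19 * \<theta>))
    \<le> 33 * D * \<theta> * sqrt 2 ^ k * (2 ^ M * (1/2) ^ N)"
proof -
  let ?a = "54 * (\<theta> * 2 ^ k) * (1/4) ^ N" and ?l = "19 * \<theta>"
  have c': "c \<in> cube M" using c cube_mono[OF N] by auto
  have "(\<Sum>x\<in>cube M. min (?a * fej_major N (x \<oplus>\<^sub>2 c)) ?l) = (\<Sum>x\<in>cube M. min (?a * fej_major N x) ?l)"
    by (rule sum_cube_add2[OF c', of "\<lambda>x. min (?a * fej_major N x) ?l"])
  also have "\<dots> = 2 ^ (M - N) * (\<Sum>x\<in>cube N. min (?a * fej_major N x) ?l)"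
  proof -
    have "depends_below N (\<lambda>x. min (?a * fej_major N x) ?l)"
      using depends_fej_major[of N] unfolding depends_below_def by metis
    then show ?thesis using sum_fiber_depends[of N "\<lambda>x. min (?a * fej_major N x) ?l" 0 M] N by simp
  qed
  also have "\<dots> \<le> 2 ^ (M - N) * (D * 2 ^ N * sqrt (?a * ?l))"
  proof (rule mult_left_mono)
    have "?a > 0" "?l > 0" using \<theta> by simp_all
    then show "(\<Sum>x\<in>cube N. min (?a * fej_major N x) ?l) \<le> D * 2 ^ N * sqrt (?a * ?l)"
      using D(2) by blast
  qed simp
  also have "\<dots> \<le> 2 ^ (M - N) * (D * 2 ^ N * (33 * \<theta> * sqrt 2 ^ k * (1/2) ^ N))"
  proof -
    have "(sqrt 2 ^ k)\<^sup>2 = (2::real) ^ k" "((1/2) ^ N)\<^sup>2 = (1/4 :: real) ^ N"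
      by (simp_all add: power2_eq_square flip: power_mult_distrib)
    then have "(33 * \<theta> * sqrt 2 ^ k * (1/2) ^ N)\<^sup>2 = 1089 * (\<theta>\<^sup>2 * 2 ^ k * (1/4) ^ N)"
      by (simp add: power_mult_distrib)
    moreover have "?a * ?l = 1026 * (\<theta>\<^sup>2 * 2 ^ k * (1/4) ^ N)"
      by (simp add: power2_eq_square)
    moreover have "0 \<le> \<theta>\<^sup>2 * 2 ^ k * (1/4) ^ N" by simp
    ultimately have "?a * ?l \<le> (33 * \<theta> * sqrt 2 ^ k * (1/2) ^ N)\<^sup>2" by linarith
    then have "sqrt (?a * ?l) \<le> 33 * \<theta> * sqrt 2 ^ k * (1/2) ^ N"
      using \<theta> by (intro real_le_lsqrt) auto
    then show ?thesis using D by (intro mult_left_mono) auto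
  qed
  also have "\<dots> = 33 * D * \<theta> * sqrt 2 ^ k * ((2 ^ (M - N) * 2 ^ N) * (1/2) ^ N)"
    by (simp add: mult_ac)
  also have "(2::real) ^ (M - N) * 2 ^ N = 2 ^ M" using N by (simp flip: power_add)
  finally show ?thesis .
qed

text \<open>Subadditivity moves the truncation inside the three sums, \<open>sum_min_atom\<close>
  pays for each summand, and \<open>card_exceed\<close> reassembles the disjoint intervals.\<close>

lemma sum_min_atoms_bound:
  assumes f: "walsh_martingale f"
    and D: "D > 0" "\<forall>N c l. c > 0 \<longrightarrow> l > 0 \<longrightarrow>
      (\<Sum>x\<in>cube N. min (c * fej_major N x) l) \<le> D * 2 ^ N * sqrt (c * l)"
    and \<theta>: "\<theta> > 0"
  shows "(\<Sum>x\<in>cube M. min (atoms_bound M f \<theta> L x) (19 * \<theta>))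
    \<le> 33 * D * \<theta> * (\<Sum>k<L. sqrt 2 ^ k * card (exceed M f (\<theta> * 2 ^ k)))"
proof -
  let ?l = "19 * \<theta>"
  let ?E = "\<lambda>k N. exceed_intervals f (\<theta> * 2 ^ k) N"
  let ?F = "\<lambda>k N c x. 54 * (\<theta> * 2 ^ k) * (1/4) ^ N * fej_major N (x \<oplus>\<^sub>2 c)"
  have F0: "0 \<le> ?F k N c x" for k N c x
    using \<theta> order_trans[OF zero_le_one fej_major_ge_1[of N "x \<oplus>\<^sub>2 c"]] by simp
  have "min (atoms_bound M f \<theta> L x) ?l \<le> (\<Sum>k<L. \<Sum>N<M. \<Sum>c\<in>?E k N. min (?F k N c x) ?l)" for x
  proof -
    have "min (atoms_bound M f \<theta> L x) ?l \<le> (\<Sum>k<L. min (\<Sum>N<M. \<Sum>c\<in>?E k N. ?F k N c x) ?l)"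
      unfolding atoms_bound_def using \<theta> F0 by (intro min_sum_le sum_nonneg) auto
    also have "\<dots> \<le> (\<Sum>k<L. \<Sum>N<M. min (\<Sum>c\<in>?E k N. ?F k N c x) ?l)"
      using \<theta> F0 by (intro sum_mono min_sum_le sum_nonneg) auto
    also have "\<dots> \<le> (\<Sum>k<L. \<Sum>N<M. \<Sum>c\<in>?E k N. min (?F k N c x) ?l)"
      using \<theta> F0 by (intro sum_mono min_sum_le) auto
    finally show ?thesis .
  qed
  then have "(\<Sum>x\<in>cube M. min (atoms_bound M f \<theta> L x) ?l)
      \<le> (\<Sum>x\<in>cube M. \<Sum>k<L. \<Sum>N<M. \<Sum>c\<in>?E k N. min (?F k N c x) ?l)"
    by (rule sum_mono)
  also have "\<dots> = (\<Sum>k<L. \<Sum>x\<in>cube M. \<Sum>N<M. \<Sum>c\<in>?E k N. min (?F k N c x) ?l)"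
    by (rule sum.swap)
  also have "\<dots> = (\<Sum>k<L. \<Sum>N<M. \<Sum>x\<in>cube M. \<Sum>c\<in>?E k N. min (?F k N c x) ?l)"
    by (rule sum.cong[OF refl], rule sum.swap)
  also have "\<dots> = (\<Sum>k<L. \<Sum>N<M. \<Sum>c\<in>?E k N. \<Sum>x\<in>cube M. min (?F k N c x) ?l)"
    by (rule sum.cong[OF refl], rule sum.cong[OF refl], rule sum.swap)
  also have "\<dots> \<le> (\<Sum>k<L. \<Sum>N<M. \<Sum>c\<in>?E k N. 33 * D * \<theta> * sqrt 2 ^ k * (2 ^ M * (1/2) ^ N))"
    by (intro sum_mono sum_min_atom[OF D _ _ \<theta>]) (auto simp: exceed_intervals_def)
  also have "\<dots> = (\<Sum>k<L. 33 * D * \<theta> * sqrt 2 ^ k * (\<Sum>N<M. \<Sum>c\<in>?E k N. 2 ^ M * (1/2) ^ N))"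
    by (simp only: sum_distrib_left)
  also have "\<dots> = 33 * D * \<theta> * (\<Sum>k<L. sqrt 2 ^ k * card (exceed M f (\<theta> * 2 ^ k)))"
    unfolding card_exceed[OF f] by (simp add: sum_distrib_left mult_ac)
  finally show ?thesis .
qed

text \<open>After exchanging the sums, a point \<open>x\<close> is charged \<open>sqrt 2 ^ k\<close>
  only while \<open>2 ^ k < 4 * finite_max M f x / \<theta>\<close>. The 8 is 4 from
  \<open>sum_sqrt2_power_le\<close> times sqrt 4.\<close>

lemma sum_card_exceed_le:
  assumes f: "walsh_martingale f" and \<theta>: "\<theta> > 0"
  shows "sqrt \<theta> * (\<Sum>k<L. sqrt 2 ^ k * card (exceed M f (\<theta> * 2 ^ k)))
    \<le> 8 * (\<Sum>x\<in>cube M. sqrt (finite_max M f x))"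
proof -
  have "(\<Sum>k<L. sqrt 2 ^ k * card (exceed M f (\<theta> * 2 ^ k)))
      = (\<Sum>k<L. \<Sum>x\<in>cube M. if x \<in> exceed M f (\<theta> * 2 ^ k) then sqrt 2 ^ k else 0)"
  proof (rule sum.cong[OF refl])
    fix k
    have "exceed M f (\<theta> * 2 ^ k) = {x \<in> cube M. x \<in> exceed M f (\<theta> * 2 ^ k)}"
      by (auto simp: exceed_def)
    then show "sqrt 2 ^ k * card (exceed M f (\<theta> * 2 ^ k))
        = (\<Sum>x\<in>cube M. if x \<in> exceed M f (\<theta> * 2 ^ k) then sqrt 2 ^ k else 0)"
      by (subst sum.inter_filter[symmetric]) simp_all
  qed
  also have "\<dots> = (\<Sum>x\<in>cube M. \<Sum>k<L. if x \<in> exceed M f (\<theta> * 2 ^ k) then sqrt 2 ^ k else 0)"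
    by (rule sum.swap)
  also have "\<dots> \<le> (\<Sum>x\<in>cube M. 4 * sqrt (4 * finite_max M f x / \<theta>))"
  proof (rule sum_mono)
    fix x
    have "(\<Sum>k<L. if x \<in> exceed M f (\<theta> * 2 ^ k) then sqrt 2 ^ k else 0)
        \<le> (\<Sum>k<L. if 2 ^ k < 4 * finite_max M f x / \<theta> then sqrt 2 ^ k else 0)"
    proof (rule sum_mono)
      fix k
      have "2 ^ k < 4 * finite_max M f x / \<theta>" if ex: "x \<in> exceed M f (\<theta> * 2 ^ k)"
      proof -
        obtain N where N: "N < M" "child_abs f N x > \<theta> * 2 ^ k"
          using ex unfolding exceed_def by blast
        note N(2)
        also have "child_abs f N x \<le> 2 * \<bar>f N x\<bar> + 2 * \<bar>f (Suc N) x\<bar>"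
          using f by (rule child_abs_le)
        also have "\<dots> \<le> 2 * finite_max M f x + 2 * finite_max M f x"
          using N(1) by (intro add_mono mult_left_mono finite_max_ge) auto
        finally show ?thesis using \<theta> by (simp add: field_simps)
      qed
      then show "(if x \<in> exceed M f (\<theta> * 2 ^ k) then sqrt 2 ^ k else 0)
          \<le> (if 2 ^ k < 4 * finite_max M f x / \<theta> then sqrt 2 ^ k else 0)" by simp
    qed
    also have "\<dots> \<le> 4 * sqrt (4 * finite_max M f x / \<theta>)"
      using \<theta> finite_max_nonneg[of M f x] by (intro sum_sqrt2_power_le) simp
    finally show "(\<Sum>k<L. if x \<in> exceed M f (\<theta> * 2 ^ k) then sqrt 2 ^ k else 0)
        \<le> 4 * sqrt (4 * finite_max M f x / \<theta>)" .
  qed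
  finally have "sqrt \<theta> * (\<Sum>k<L. sqrt 2 ^ k * card (exceed M f (\<theta> * 2 ^ k)))
      \<le> sqrt \<theta> * (\<Sum>x\<in>cube M. 4 * sqrt (4 * finite_max M f x / \<theta>))"
    using \<theta> by (intro mult_left_mono) auto
  also have "\<dots> = 8 * (\<Sum>x\<in>cube M. sqrt (finite_max M f x))"
    using \<theta> by (simp add: sum_distrib_left real_sqrt_divide real_sqrt_mult)
  finally show ?thesis .
qed

text \<open>Chebyshev's inequality for the truncated sum. 38 = 19 + 19: the bounded part uses up one
  half, so at a bad point off \<open>exceed\<close> the truncation at \<open>19 * \<theta>\<close>
  is saturated. Points of \<open>exceed\<close> are counted directly.\<close>

lemma finite_weak_type: "\<exists>C>0. \<forall>f M \<theta>. walsh_martingale f \<longrightarrow> 1 \<le> M \<longrightarrow> \<theta> > 0 \<longrightarrow>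
  sqrt \<theta> * card {x \<in> cube M. \<exists>n\<in>{1..2 ^ M}. \<bar>\<Sum>k<n. partial_sum k f x\<bar> > real n * (38 * \<theta>)}
    \<le> C * (\<Sum>x\<in>cube M. sqrt (finite_max M f x))"
proof -
  obtain D where D: "D > 0" "\<forall>N c l. c > 0 \<longrightarrow> l > 0 \<longrightarrow>
      (\<Sum>x\<in>cube N. min (c * fej_major N x) l) \<le> D * 2 ^ N * sqrt (c * l)"
    using sum_min_fej_major by blast
  show ?thesis
  proof (intro exI[of _ "8 * (1 + 2 * D)"] conjI allI impI)
    fix f and M :: nat and \<theta> :: real
    assume f: "walsh_martingale f" and M: "1 \<le> M" and \<theta>: "\<theta> > 0"
    define Bad where "Bad = {x \<in> cube M. \<exists>n\<in>{1..2 ^ M}.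
        \<bar>\<Sum>k<n. partial_sum k f x\<bar> > real n * (38 * \<theta>)}"
    let ?E = "\<lambda>k::nat. exceed M f (\<theta> * 2 ^ k)"
    have finB: "finite Bad" unfolding Bad_def by simp
    \<comment> \<open>A crude bound that only provides some finite number \<open>L\<close> of
      thresholds; the final constant is independent of it.\<close>
    define R where "R = (\<Sum>t\<in>cube M. \<Sum>n<M. child_abs f n t)"
    have ca0: "0 \<le> child_abs f n t" for n t by (simp add: child_abs_def)
    have R: "child_abs f n t \<le> R" if "t \<in> cube M" "n < M" for n t
    proof -
      have "child_abs f n t \<le> (\<Sum>n<M. child_abs f n t)"
        using that ca0 by (intro member_le_sum) auto
      also have "\<dots> \<le> R" unfolding R_def using that ca0
        by (intro member_le_sum[where f = "\<lambda>t. \<Sum>n<M. child_abs f n t"] sum_nonneg) auto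
      finally show ?thesis .
    qed
    obtain L where "R / \<theta> < 2 ^ L" using real_arch_pow[of 2 "R / \<theta>"] by auto
    then have L: "R \<le> \<theta> * 2 ^ L" using \<theta> by (simp add: field_simps)
    have big: "19 * \<theta> \<le> atoms_bound M f \<theta> L x" if x: "x \<in> Bad - ?E 0" for x
    proof -
      obtain n where n: "1 \<le> n" "n \<le> 2 ^ M" "\<bar>\<Sum>k<n. partial_sum k f x\<bar> > real n * (38 * \<theta>)"
        using x unfolding Bad_def by auto
      have "\<bar>\<Sum>k<n. partial_sum k f x\<bar> \<le> real n * (19 * \<theta> + atoms_bound M f \<theta> L x)"
      proof (rule atoms_pointwise[OF f M \<theta>])
        show "child_abs f n t \<le> \<theta> * 2 ^ L" if "t \<in> cube M" "n < M" for t n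
          using R[OF that] L by linarith
      qed (use x n in \<open>auto simp: Bad_def\<close>)
      then have "real n * (38 * \<theta>) < real n * (19 * \<theta> + atoms_bound M f \<theta> L x)"
        using n(3) by linarith
      then have "38 * \<theta> < 19 * \<theta> + atoms_bound M f \<theta> L x"
        using n(1) by (simp add: mult_less_cancel_left_pos)
      then show ?thesis by linarith
    qed
    have "19 * \<theta> * card (Bad - ?E 0) = (\<Sum>x\<in>Bad - ?E 0. min (atoms_bound M f \<theta> L x) (19 * \<theta>))"
    proof -
      have "(\<Sum>x\<in>Bad - ?E 0. min (atoms_bound M f \<theta> L x) (19 * \<theta>)) = (\<Sum>x\<in>Bad - ?E 0. 19 * \<theta>)"
        by (rule sum.cong[OF refl], rule min_absorb2, rule big)
      then show ?thesis by simp
    qed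
    also have "\<dots> \<le> (\<Sum>x\<in>cube M. min (atoms_bound M f \<theta> L x) (19 * \<theta>))"
    proof (rule sum_mono2)
      show "0 \<le> min (atoms_bound M f \<theta> L x) (19 * \<theta>)" for x
        unfolding atoms_bound_def using \<theta> order_trans[OF zero_le_one fej_major_ge_1]
        by (auto intro!: sum_nonneg mult_nonneg_nonneg)
    qed (auto simp: Bad_def)
    also have "\<dots> \<le> 33 * D * \<theta> * (\<Sum>k<L. sqrt 2 ^ k * card (?E k))"
      using f D \<theta> by (rule sum_min_atoms_bound)
    finally have "\<theta> * (19 * card (Bad - ?E 0)) \<le> \<theta> * (33 * D * (\<Sum>k<L. sqrt 2 ^ k * card (?E k)))"
      by (simp add: mult_ac)
    then have "19 * card (Bad - ?E 0) \<le> 33 * D * (\<Sum>k<L. sqrt 2 ^ k * card (?E k))"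
      using \<theta> by (simp only: mult_le_cancel_left_pos)
    moreover have pos: "0 \<le> D * (\<Sum>k<L. sqrt 2 ^ k * card (?E k))"
      using D(1) by (intro mult_nonneg_nonneg sum_nonneg) auto
    ultimately have 1: "card (Bad - ?E 0) \<le> 2 * (D * (\<Sum>k<L. sqrt 2 ^ k * card (?E k)))"
      by simp
    have "card Bad \<le> card (Bad - ?E 0) + card (?E 0)"
      using card_mono[of "(Bad - ?E 0) \<union> ?E 0" Bad] card_Un_le[of "Bad - ?E 0" "?E 0"] finB by force
    then have "real (card Bad) \<le> real (card (?E 0)) + 2 * D * (\<Sum>k<L. sqrt 2 ^ k * card (?E k))"
      using 1 by simp
    \<comment> \<open>\<open>Suc L\<close> keeps the term \<open>k = 0\<close>, the cardinality of
      \<open>exceed M f \<theta>\<close>, in the sum even if \<open>L = 0\<close>.\<close>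
    also have "\<dots> \<le> (1 + 2 * D) * (\<Sum>k<Suc L. sqrt 2 ^ k * card (?E k))"
    proof -
      let ?s = "\<lambda>k. sqrt 2 ^ k * card (?E k)"
      have "?s 0 \<le> (\<Sum>k<Suc L. ?s k)"
        by (rule member_le_sum[where f = ?s]) auto
      moreover have "2 * D * (\<Sum>k<L. ?s k) \<le> 2 * D * (\<Sum>k<Suc L. ?s k)"
        using D(1) by (intro mult_left_mono sum_mono2) auto
      ultimately show ?thesis unfolding distrib_right by simp
    qed
    finally have "sqrt \<theta> * card Bad \<le> sqrt \<theta> * ((1 + 2 * D) * (\<Sum>k<Suc L. sqrt 2 ^ k * card (?E k)))"
      using \<theta> by (intro mult_left_mono) auto
    also have "\<dots> = (1 + 2 * D) * (sqrt \<theta> * (\<Sum>k<Suc L. sqrt 2 ^ k * card (?E k)))"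
      by (simp only: mult_ac)
    also have "\<dots> \<le> (1 + 2 * D) * (8 * (\<Sum>x\<in>cube M. sqrt (finite_max M f x)))"
      using D(1) by (intro mult_left_mono sum_card_exceed_le f \<theta>) auto
    also have "\<dots> = 8 * (1 + 2 * D) * (\<Sum>x\<in>cube M. sqrt (finite_max M f x))"
      by (simp only: mult_ac)
    finally show "sqrt \<theta> * card {x \<in> cube M. \<exists>n\<in>{1..2 ^ M}.
        \<bar>\<Sum>k<n. partial_sum k f x\<bar> > real n * (38 * \<theta>)}
      \<le> 8 * (1 + 2 * D) * (\<Sum>x\<in>cube M. sqrt (finite_max M f x))"
      unfolding Bad_def .
  qed (use D in auto)
qed

subsection \<open>Maximal operator of the T means\<close>

text \<open>Summation by parts in inductive form: replacing the weights by the last one costs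
  partial sums weighted with the nonnegative increments of \<open>q\<close>, which telescope. The
  sum with constant weight accounts for the second copy, hence the 2.\<close>

lemma abel_bound:
  fixes q S :: "nat \<Rightarrow> real"
  assumes q: "mono q" "\<And>k. q k \<ge> 0"
    and A: "\<And>j. 1 \<le> j \<Longrightarrow> j \<le> n \<Longrightarrow> \<bar>\<Sum>k<j. S k\<bar> \<le> real j * s" and n: "1 \<le> n"
  shows "\<bar>\<Sum>k<n. q k * S k\<bar> \<le> 2 * real n * q (n - 1) * s"
proof -
  have "\<bar>(\<Sum>k<Suc m. q k * S k) - q m * (\<Sum>k<Suc m. S k)\<bar> \<le> q m * real (Suc m) * s"
    if "Suc m \<le> n" for m
    using that
  proof (induction m)
    case 0
    have "0 \<le> s" using A[of 1] n by simp
    then show ?case using q(2)[of 0] by simp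
  next
    case (Suc m)
    define a where "a = (\<Sum>k<Suc m. S k)"
    have d: "q m \<le> q (Suc m)" using q(1) by (simp add: monoD)
    have a: "\<bar>a\<bar> \<le> real (Suc m) * s" unfolding a_def using Suc.prems by (intro A) auto
    have "0 \<le> real (Suc m) * s" using a by (rule order_trans[OF abs_ge_zero])
    then have s: "0 \<le> s" by (simp add: zero_le_mult_iff)
    have "(\<Sum>k<Suc (Suc m). q k * S k) - q (Suc m) * (\<Sum>k<Suc (Suc m). S k)
        = ((\<Sum>k<Suc m. q k * S k) - q m * a) - (q (Suc m) - q m) * a"
      unfolding a_def by (simp add: algebra_simps)
    also have "\<bar>\<dots>\<bar> \<le> q m * real (Suc m) * s + (q (Suc m) - q m) * (real (Suc m) * s)"
    proof -
      have "\<bar>(q (Suc m) - q m) * a\<bar> \<le> (q (Suc m) - q m) * (real (Suc m) * s)"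
        unfolding abs_mult using d a by (intro mult_mono) auto
      moreover have "\<bar>(\<Sum>k<Suc m. q k * S k) - q m * a\<bar> \<le> q m * real (Suc m) * s"
        using Suc unfolding a_def by simp
      ultimately show ?thesis by linarith
    qed
    also have "\<dots> = q (Suc m) * real (Suc m) * s" by (simp add: algebra_simps)
    also have "\<dots> \<le> q (Suc m) * real (Suc (Suc m)) * s"
      using q(2)[of "Suc m"] s by (intro mult_right_mono mult_left_mono) auto
    finally show ?case .
  qed
  from this[of "n - 1"] n have
    1: "\<bar>(\<Sum>k<n. q k * S k) - q (n - 1) * (\<Sum>k<n. S k)\<bar> \<le> q (n - 1) * real n * s" by simp
  have "\<bar>q (n - 1) * (\<Sum>k<n. S k)\<bar> \<le> q (n - 1) * (real n * s)"
    unfolding abs_mult using q(2)[of "n - 1"] A[of n] n by (intro mult_mono) auto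
  moreover have "2 * real n * q (n - 1) * s = q (n - 1) * real n * s + q (n - 1) * (real n * s)"
    by simp
  ultimately show ?thesis using 1 by linarith
qed

context
  fixes q :: "nat \<Rightarrow> real"
  assumes mono_q: "mono q" and nonneg: "\<And>k. q k \<ge> 0" and q0: "q 0 > 0"
begin

lemma q_pos: "q k > 0"
  using monoD[OF mono_q, of 0 k] q0 by simp

lemma Qsum_pos: "1 \<le> n \<Longrightarrow> Qsum q n > 0"
  unfolding Qsum_def by (rule sum_pos) (auto simp: q_pos lessThan_empty_iff)

lemma Qsum_le: "n \<le> Suc k \<Longrightarrow> Qsum q n \<le> real n * q k"
proof -
  assume "n \<le> Suc k"
  then have "(\<Sum>j<n. q j) \<le> (\<Sum>j<n. q k)" by (intro sum_mono monoD[OF mono_q]) auto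
  then show ?thesis by (simp add: Qsum_def)
qed

text \<open>The finitely many \<open>n\<close> below the threshold are covered by
  \<open>q (n - 1) \<le> Qsum q n\<close> and \<open>n < N\<close>, hence the summand
  \<open>N\<close> in the constant.\<close>

lemma growth_bound:
  assumes "(\<lambda>n. q (n - 1) / Qsum q n) \<in> O(\<lambda>n. 1 / real n)"
  obtains K where "K > 0" "\<And>n. 1 \<le> n \<Longrightarrow> real n * q (n - 1) \<le> K * Qsum q n"
proof -
  obtain c where c: "c > 0"
    "eventually (\<lambda>n. norm (q (n - 1) / Qsum q n) \<le> c * norm (1 / real n)) at_top"
    using assms by (rule landau_o.bigE)
  then obtain N where N: "\<And>n. n \<ge> N \<Longrightarrow> norm (q (n - 1) / Qsum q n) \<le> c * norm (1 / real n)"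
    unfolding eventually_sequentially by blast
  show thesis
  proof (rule that[of "c + real N"])
    fix n :: nat assume n: "1 \<le> n"
    have Q: "Qsum q n > 0" using n by (rule Qsum_pos)
    show "real n * q (n - 1) \<le> (c + real N) * Qsum q n"
    proof (cases "n \<ge> N")
      case True
      have "q (n - 1) / Qsum q n \<le> c / real n"
        using N[OF True] Q nonneg[of "n - 1"] by simp
      then have "real n * q (n - 1) \<le> c * Qsum q n" using Q n by (simp add: field_simps)
      moreover have "0 \<le> real N * Qsum q n" using Q by simp
      ultimately show ?thesis unfolding distrib_right by linarith
    next
      case False
      have "q (n - 1) \<le> Qsum q n"
        unfolding Qsum_def using n nonneg by (intro member_le_sum) auto
      then have "real n * q (n - 1) \<le> (c + real N) * Qsum q n"
        using False c(1) nonneg by (intro mult_mono) auto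
      then show ?thesis .
    qed
  qed (use c in auto)
qed

lemma T_mean_bound:
  assumes K: "K > 0" "\<And>n. 1 \<le> n \<Longrightarrow> real n * q (n - 1) \<le> K * Qsum q n"
    and s: "\<And>j. 1 \<le> j \<Longrightarrow> j \<le> n \<Longrightarrow> \<bar>\<Sum>k<j. partial_sum k f x\<bar> \<le> real j * s" and n: "1 \<le> n"
  shows "\<bar>T_mean q n f x\<bar> \<le> 2 * K * s"
proof -
  have s0: "0 \<le> s" using s[of 1] n by simp
  have Q: "Qsum q n > 0" using n by (rule Qsum_pos)
  have "\<bar>\<Sum>k<n. q k * partial_sum k f x\<bar> \<le> 2 * real n * q (n - 1) * s"
    using mono_q nonneg s n by (rule abel_bound)
  also have "\<dots> = (real n * q (n - 1)) * (2 * s)" by simp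
  also have "\<dots> \<le> (K * Qsum q n) * (2 * s)"
    using K(2)[OF n] s0 by (intro mult_right_mono) auto
  finally have "\<bar>\<Sum>k<n. q k * partial_sum k f x\<bar> \<le> (2 * K * s) * Qsum q n" by (simp add: mult_ac)
  then show ?thesis using Q by (simp add: T_mean_def abs_mult divide_le_eq)
qed

end

lemma depends_partial_sum: "k \<le> 2 ^ M \<Longrightarrow> depends_below M (partial_sum k f)"
  unfolding depends_below_def partial_sum_def
proof (intro allI impI sum.cong refl)
  fix x y :: "nat \<Rightarrow> bool" and i assume *: "k \<le> 2 ^ M" "\<forall>j<M. x j = y j" "i \<in> {..<k}"
  have "i < k" using * by simp
  from this *(1) have "i < 2 ^ M" by (rule less_le_trans)
  then have "kaczmarz i x = kaczmarz i y"
    by (rule depends_belowD[OF depends_kaczmarz]) (use * in auto)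
  then show "fourier_coeff f i * kaczmarz i x = fourier_coeff f i * kaczmarz i y" by simp
qed

lemma depends_T_mean:
  assumes "n \<le> 2 ^ M" shows "depends_below M (T_mean q n f)"
  unfolding depends_below_def
proof (intro allI impI)
  fix x y :: "nat \<Rightarrow> bool" assume xy: "\<forall>j<M. x j = y j"
  have "partial_sum k f x = partial_sum k f y" if "k < n" for k
    by (rule depends_belowD[OF depends_partial_sum[of k M]]) (use that assms xy in auto)
  then show "T_mean q n f x = T_mean q n f y" unfolding T_mean_def by simp
qed

lemma hardy_pow_ge:
  assumes f: "walsh_martingale f"
  shows "ennreal ((\<Sum>x\<in>cube M. sqrt (finite_max M f x)) / 2 ^ M) \<le> hardy_pow (1/2) f"
proof -
  have dep: "depends_below M (\<lambda>x. sqrt (finite_max M f x))"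
    unfolding depends_below_def
  proof (intro allI impI)
    fix x y :: "nat \<Rightarrow> bool" assume xy: "\<forall>j<M. x j = y j"
    have "f n x = f n y" if "n \<le> M" for n
      by (rule depends_belowD[OF martingale_depends[OF f]]) (use xy that in auto)
    then have "(\<lambda>n. \<bar>f n x\<bar>) ` {..M} = (\<lambda>n. \<bar>f n y\<bar>) ` {..M}" by (intro image_cong) auto
    then show "sqrt (finite_max M f x) = sqrt (finite_max M f y)" by (simp add: finite_max_def)
  qed
  have "ennreal ((\<Sum>x\<in>cube M. sqrt (finite_max M f x)) / 2 ^ M)
      = (\<integral>\<^sup>+x. ennreal (sqrt (finite_max M f x)) \<partial>walsh_measure)"
    by (rule nn_integral_depends_below[OF dep, symmetric]) (simp add: finite_max_nonneg)
  also have "\<dots> \<le> hardy_pow (1/2) f"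
    unfolding hardy_pow_def
  proof (rule nn_integral_mono)
    fix x
    have "finite_max M f x \<in> (\<lambda>n. \<bar>f n x\<bar>) ` {..M}"
      unfolding finite_max_def by (rule Max_in) auto
    then obtain n where "finite_max M f x = \<bar>f n x\<bar>" by blast
    then have "ennreal (sqrt (finite_max M f x)) = ennreal (\<bar>f n x\<bar> powr (1/2))"
      by (simp add: powr_half_sqrt)
    also have "\<dots> \<le> (SUP n. ennreal (\<bar>f n x\<bar> powr (1/2)))" by (rule SUP_upper) simp
    finally show "ennreal (sqrt (finite_max M f x)) \<le> (SUP n. ennreal (\<bar>f n x\<bar> powr (1/2)))" .
  qed
  finally show ?thesis .
qed

text \<open>The finite estimate is applied to the means of order at most a power of two; since its
  constant does not depend on the resolution, continuity of the measure from below gives the full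
  supremum.\<close>

lemma T_max_weak_bound:
  fixes q :: "nat \<Rightarrow> real"
  assumes q: "mono q" "\<And>k. q k \<ge> 0" "q 0 > 0"
    and O: "(\<lambda>n. q (n - 1) / Qsum q n) \<in> O(\<lambda>n. 1 / real n)"
  shows "\<exists>C::real. \<forall>f. walsh_martingale f \<longrightarrow>
      weak_pow (1/2) (T_max q f) \<le> ennreal C * hardy_pow (1/2) f"
proof -
  obtain K where K: "K > 0" "\<And>n. 1 \<le> n \<Longrightarrow> real n * q (n - 1) \<le> K * Qsum q n"
    using growth_bound[OF q O] by blast
  obtain C where C: "C > 0" "\<forall>f M \<theta>. walsh_martingale f \<longrightarrow> 1 \<le> M \<longrightarrow> \<theta> > 0 \<longrightarrow>
    sqrt \<theta> * card {x \<in> cube M. \<exists>n\<in>{1..2 ^ M}. \<bar>\<Sum>k<n. partial_sum k f x\<bar> > real n * (38 * \<theta>)}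
      \<le> C * (\<Sum>x\<in>cube M. sqrt (finite_max M f x))"
    using finite_weak_type by blast
  show ?thesis
  proof (intro exI[of _ "sqrt (76 * K) * C"] allI impI)
    fix f assume f: "walsh_martingale f"
    show "weak_pow (1/2) (T_max q f) \<le> ennreal (sqrt (76 * K) * C) * hardy_pow (1/2) f"
      unfolding weak_pow_def
    proof (rule SUP_least)
      fix t :: real assume "t \<in> {0<..}"
      then have t: "t > 0" by simp
      \<comment> \<open>\<open>Suc M\<close> because \<open>finite_weak_type\<close> requires a
        positive level.\<close>
      define A where "A M = {x. \<exists>n\<in>{1..2 ^ Suc M}. \<bar>T_mean q n f x\<bar> > t}" for M
      have depA: "depends_below (Suc M) (\<lambda>x. \<exists>n\<in>{1..2 ^ Suc M}. \<bar>T_mean q n f x\<bar> > t)" for M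
        unfolding depends_below_def
      proof (intro allI impI bex_cong refl)
        fix x y :: "nat \<Rightarrow> bool" and n :: nat
        assume *: "\<forall>j<Suc M. x j = y j" "n \<in> {1..2 ^ Suc M}"
        have "T_mean q n f x = T_mean q n f y"
          by (rule depends_belowD[OF depends_T_mean[of n "Suc M"]]) (use * in auto)
        then show "(t < \<bar>T_mean q n f x\<bar>) = (t < \<bar>T_mean q n f y\<bar>)" by simp
      qed
      have "{x \<in> space walsh_measure. ennreal t < T_max q f x} = (\<Union>M. A M)"
      proof (intro equalityI subsetI)
        fix x assume "x \<in> {x \<in> space walsh_measure. ennreal t < T_max q f x}"
        then obtain n where n: "1 \<le> n" "ennreal t < ennreal \<bar>T_mean q n f x\<bar>"
          unfolding T_max_def by (auto simp: less_SUP_iff)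
        have "n < 2 ^ Suc n" by (rule less_trans[OF lessI less_exp])
        then have "x \<in> A n" unfolding A_def using n t by (auto simp: ennreal_less_iff intro!: bexI[of _ n])
        then show "x \<in> (\<Union>M. A M)" by blast
      next
        fix x assume "x \<in> (\<Union>M. A M)"
        then obtain n where "1 \<le> n" "\<bar>T_mean q n f x\<bar> > t" unfolding A_def by auto
        then show "x \<in> {x \<in> space walsh_measure. ennreal t < T_max q f x}"
          unfolding T_max_def using t by (auto simp: less_SUP_iff ennreal_less_iff)
      qed
      then have "emeasure walsh_measure {x \<in> space walsh_measure. ennreal t < T_max q f x}
          = emeasure walsh_measure (\<Union>M. A M)" by simp
      also have "\<dots> = (SUP M. emeasure walsh_measure (A M))"
      proof (rule SUP_emeasure_incseq[symmetric])
        show "range A \<subseteq> sets walsh_measure"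
          unfolding A_def using emeasure_depends_below(1)[OF depA] by blast
        show "incseq A"
        proof (rule incseq_SucI, rule subsetI)
          fix M x assume "x \<in> A M"
          then obtain n where "1 \<le> n" "n \<le> 2 ^ Suc M" "\<bar>T_mean q n f x\<bar> > t" unfolding A_def by auto
          then show "x \<in> A (Suc M)" unfolding A_def by (auto intro!: bexI[of _ n])
        qed
      qed
      finally have em: "emeasure walsh_measure {x \<in> space walsh_measure. ennreal t < T_max q f x}
          = (SUP M. emeasure walsh_measure (A M))" .
      have each: "ennreal (t powr (1/2)) * emeasure walsh_measure (A M)
          \<le> ennreal (sqrt (76 * K) * C) * hardy_pow (1/2) f" for M
      proof -
        \<comment> \<open>76 * K = 2 * K * 38, with the 2 * K of \<open>T_mean_bound\<close> and the
          38 of \<open>finite_weak_type\<close>.\<close>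
        let ?M = "Suc M" and ?\<theta> = "t / (76 * K)"
        let ?A = "{c \<in> cube ?M. \<exists>n\<in>{1..2 ^ ?M}. \<bar>T_mean q n f c\<bar> > t}"
        let ?B = "{x \<in> cube ?M. \<exists>n\<in>{1..2 ^ ?M}. \<bar>\<Sum>k<n. partial_sum k f x\<bar> > real n * (38 * ?\<theta>)}"
        let ?S = "\<Sum>x\<in>cube ?M. sqrt (finite_max ?M f x)"
        have S0: "0 \<le> ?S" by (intro sum_nonneg) (simp add: finite_max_nonneg)
        have \<theta>: "?\<theta> > 0" using t K by simp
        have "?A \<subseteq> ?B"
        proof
          fix x assume x: "x \<in> ?A"
          then obtain n where n: "1 \<le> n" "n \<le> 2 ^ ?M" "\<bar>T_mean q n f x\<bar> > t" by auto
          have "\<exists>j\<in>{1..2 ^ ?M}. \<bar>\<Sum>k<j. partial_sum k f x\<bar> > real j * (38 * ?\<theta>)"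
          proof (rule ccontr)
            assume "\<not> ?thesis"
            then have "\<bar>\<Sum>k<j. partial_sum k f x\<bar> \<le> real j * (38 * ?\<theta>)" if "1 \<le> j" "j \<le> n" for j
              using that n(2) by (auto simp: not_less)
            then have "\<bar>T_mean q n f x\<bar> \<le> 2 * K * (38 * ?\<theta>)"
              using n(1) by (intro T_mean_bound[OF q K]) auto
            also have "\<dots> = t" using K by simp
            finally show False using n(3) by simp
          qed
          with x show "x \<in> ?B" by simp
        qed
        then have "card ?A \<le> card ?B" by (intro card_mono) auto
        then have "sqrt ?\<theta> * card ?A \<le> sqrt ?\<theta> * card ?B"
          using \<theta> by (intro mult_left_mono) auto
        also have "\<dots> \<le> C * ?S" by (rule C(2)[rule_format, OF f _ \<theta>]) simp
        finally have "sqrt (76 * K) * (sqrt ?\<theta> * card ?A) \<le> sqrt (76 * K) * (C * ?S)"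
          using K by (intro mult_left_mono) auto
        moreover have "sqrt (76 * K) * sqrt ?\<theta> = t powr (1/2)"
          using K t by (simp add: real_sqrt_mult[symmetric] powr_half_sqrt)
        ultimately have "t powr (1/2) * card ?A \<le> sqrt (76 * K) * C * ?S"
          by (simp add: mult.assoc[symmetric])
        then have le: "t powr (1/2) * (card ?A / 2 ^ ?M) \<le> sqrt (76 * K) * C * (?S / 2 ^ ?M)"
          by (simp add: divide_right_mono del: power_Suc)
        have "ennreal (t powr (1/2)) * emeasure walsh_measure (A M)
            = ennreal (t powr (1/2)) * ennreal (card ?A / 2 ^ ?M)"
          unfolding A_def emeasure_depends_below(2)[OF depA] ..
        also have "\<dots> = ennreal (t powr (1/2) * (card ?A / 2 ^ ?M))"
          by (rule ennreal_mult[symmetric]) auto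
        also have "\<dots> \<le> ennreal (sqrt (76 * K) * C * (?S / 2 ^ ?M))"
          using le by (rule ennreal_leI)
        also have "\<dots> = ennreal (sqrt (76 * K) * C) * ennreal (?S / 2 ^ ?M)"
          using K C(1) S0 by (intro ennreal_mult) auto
        also have "\<dots> \<le> ennreal (sqrt (76 * K) * C) * hardy_pow (1/2) f"
          by (intro mult_left_mono hardy_pow_ge f) simp
        finally show ?thesis .
      qed
      show "ennreal (t powr (1/2)) * emeasure walsh_measure {x \<in> space walsh_measure. ennreal t < T_max q f x}
          \<le> ennreal (sqrt (76 * K) * C) * hardy_pow (1/2) f"
        unfolding em SUP_mult_left_ennreal by (rule SUP_least) (rule each)
    qed
  qed
qed

section \<open>Divergence of the means for exponents below 1/2\<close>

text \<open>
  The Fourier coefficient of \<open>lacunary p\<close> at \<open>2 ^ n\<close> is \<open>2 powr (n / (2 * p))\<close>. The exponent lies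
  strictly between \<open>n\<close>, which is needed for divergence of the means, and \<open>n * (1 / p - 1)\<close>, which is
  needed for membership in the Hardy space.
\<close>

definition lacunary :: "real \<Rightarrow> nat \<Rightarrow> (nat \<Rightarrow> bool) \<Rightarrow> real" where
  "lacunary p m x = (\<Sum>n<m. 2 powr (n / (2 * p)) * 2 ^ n *
     (if \<forall>j<n. \<not> x j then rademacher n x else 0))"

lemma walsh_martingale_lacunary: "walsh_martingale (lacunary p)"
  unfolding walsh_martingale_def
proof (intro conjI allI impI)
  fix n :: nat and x y :: "nat \<Rightarrow> bool" assume xy: "\<forall>j<n. x j = y j"
  then show "lacunary p n x = lacunary p n y"
    unfolding lacunary_def rademacher_def by (intro sum.cong refl) auto
next
  fix n x
  have "(\<Sum>i<n. 2 powr (i / (2 * p)) * 2 ^ i * (if \<forall>j<i. \<not> (x(n := b)) j then rademacher i (x(n := b)) else 0))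
      = lacunary p n x" for b
    unfolding lacunary_def rademacher_def by (intro sum.cong refl) auto
  moreover have "(\<forall>j<n. \<not> (x(n := b)) j) \<longleftrightarrow> (\<forall>j<n. \<not> x j)" for b by auto
  ultimately have "lacunary p (Suc n) (x(n := b)) = lacunary p n x + 2 powr (n / (2 * p)) * 2 ^ n *
      (if \<forall>j<n. \<not> x j then (if b then -1 else 1) else 0)" for b
    unfolding lacunary_def[of p "Suc n"] sum.lessThan_Suc by (simp add: rademacher_def)
  then show "lacunary p n x = (lacunary p (Suc n) (x(n := False)) + lacunary p (Suc n) (x(n := True))) / 2"
    by simp
qed

text \<open>After normalising \<open>u + v\<close> to 1, subadditivity is
  \<open>r \<le> r powr p\<close> on the unit interval.\<close>

lemma powr_sum_le_sum_powr:
  fixes a :: "nat \<Rightarrow> real"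
  assumes p: "0 < p" "p \<le> 1" and a: "\<And>n. a n \<ge> 0"
  shows "(\<Sum>n<m. a n) powr p \<le> (\<Sum>n<m. a n powr p)"
proof (induction m)
  case (Suc m)
  have two: "(u + v) powr p \<le> u powr p + v powr p" if "u \<ge> 0" "v \<ge> 0" for u v :: real
  proof (cases "u + v = 0")
    case False
    then have w: "u + v > 0" using that by simp
    have le: "r \<le> r powr p" if "0 \<le> r" "r \<le> 1" for r :: real
      using powr_mono'[of p 1 r] that p by simp
    have "1 = u / (u + v) + v / (u + v)" using w by (simp flip: add_divide_distrib)
    also have "\<dots> \<le> (u / (u + v)) powr p + (v / (u + v)) powr p"
      using that w by (intro add_mono le) auto
    also have "\<dots> = (u powr p + v powr p) / (u + v) powr p"
      using that w by (simp add: powr_divide add_divide_distrib)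
    finally show ?thesis using w by (simp add: le_divide_eq)
  qed simp
  have "(\<Sum>n<Suc m. a n) powr p \<le> (\<Sum>n<m. a n) powr p + a m powr p"
    using two[of "\<Sum>n<m. a n" "a m"] a by (simp add: sum_nonneg)
  then show ?case using Suc by simp
qed simp

text \<open>The p-th power of the maximal function is at most a series of weighted indicators of
  intervals around 0, whose integral is geometric with ratio
  \<open>2 powr (p - 1/2) < 1\<close>.\<close>

lemma hardy_pow_lacunary:
  assumes p: "0 < p" "p < 1/2"
  shows "hardy_pow p (lacunary p) < \<infinity>"
proof -
  define w where "w n = (2 powr (n / (2 * p)) * 2 ^ n) powr p" for n :: nat
  let ?Z = "\<lambda>_::nat. False"
  have w0: "w n \<ge> 0" for n by (simp add: w_def)
  have wn: "w n * (1 / 2 ^ n) = (2 powr (p - 1/2)) ^ n" for n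
  proof -
    have "w n = 2 powr (real n / 2) * 2 powr (real n * p)"
      using p by (simp add: w_def powr_mult powr_powr powr_realpow[symmetric])
    moreover have "(1 / 2 ^ n :: real) = 2 powr (- real n)"
      by (simp add: powr_minus powr_realpow divide_inverse)
    moreover have "(2 powr (p - 1/2)) ^ n = 2 powr (real n * (p - 1/2))"
      by (subst powr_realpow[symmetric]) (simp_all add: powr_powr mult.commute)
    ultimately show ?thesis by (simp add: powr_add[symmetric] algebra_simps)
  qed
  have "hardy_pow p (lacunary p) \<le> (\<integral>\<^sup>+x. (\<Sum>n. ennreal (w n) * indicator (cyl n ?Z) x) \<partial>walsh_measure)"
    unfolding hardy_pow_def
  proof (intro nn_integral_mono SUP_least)
    fix x and m :: nat
    let ?a = "\<lambda>n. 2 powr (n / (2 * p)) * 2 ^ n * indicator (cyl n ?Z) x"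
    have "\<bar>lacunary p m x\<bar> \<le> (\<Sum>n<m. ?a n)"
      unfolding lacunary_def
      by (rule order_trans[OF sum_abs], rule sum_mono)
         (auto simp: abs_mult rademacher_def indicator_def cyl_def)
    then have "\<bar>lacunary p m x\<bar> powr p \<le> (\<Sum>n<m. ?a n) powr p"
      using p by (intro powr_mono2) auto
    also have "\<dots> \<le> (\<Sum>n<m. ?a n powr p)"
      using p by (intro powr_sum_le_sum_powr) auto
    also have "\<dots> = (\<Sum>n<m. w n * indicator (cyl n ?Z) x)"
      by (intro sum.cong refl) (auto simp: w_def indicator_def)
    finally have "ennreal (\<bar>lacunary p m x\<bar> powr p) \<le> ennreal (\<Sum>n<m. w n * indicator (cyl n ?Z) x)"
      by (rule ennreal_leI)
    also have "\<dots> = (\<Sum>n<m. ennreal (w n) * indicator (cyl n ?Z) x)"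
      using w0 by (subst sum_ennreal[symmetric]) (auto simp: ennreal_mult'' ennreal_indicator intro!: sum.cong)
    also have "\<dots> \<le> (\<Sum>n. ennreal (w n) * indicator (cyl n ?Z) x)"
      by (rule sum_le_suminf) auto
    finally show "ennreal (\<bar>lacunary p m x\<bar> powr p) \<le> (\<Sum>n. ennreal (w n) * indicator (cyl n ?Z) x)" .
  qed
  also have "\<dots> = (\<Sum>n. \<integral>\<^sup>+x. ennreal (w n) * indicator (cyl n ?Z) x \<partial>walsh_measure)"
    by (intro nn_integral_suminf borel_measurable_times_ennreal borel_measurable_const
        borel_measurable_indicator) (simp add: cyl_sets_emeasure)
  also have "\<dots> = (\<Sum>n. ennreal ((2 powr (p - 1/2)) ^ n))"
  proof (rule suminf_cong)
    fix n
    have "(\<integral>\<^sup>+x. ennreal (w n) * indicator (cyl n ?Z) x \<partial>walsh_measure) = ennreal (w n) * ennreal (1 / 2 ^ n)"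
      using cyl_sets_emeasure[of n ?Z] by (simp add: nn_integral_cmult_indicator)
    also have "\<dots> = ennreal ((2 powr (p - 1/2)) ^ n)"
      by (subst ennreal_mult[symmetric]) (simp_all add: w0 wn[symmetric])
    finally show "(\<integral>\<^sup>+x. ennreal (w n) * indicator (cyl n ?Z) x \<partial>walsh_measure)
        = ennreal ((2 powr (p - 1/2)) ^ n)" .
  qed
  also have "\<dots> = ennreal (\<Sum>n. (2 powr (p - 1/2)) ^ n)"
  proof (rule suminf_ennreal2)
    have "2 powr (p - 1/2) < 2 powr (0::real)" using p by (intro powr_less_mono) auto
    then show "summable (\<lambda>n. (2 powr (p - 1/2)) ^ n :: real)" by (intro summable_geometric) simp
  qed simp
  also have "\<dots> < \<infinity>" by simp
  finally show ?thesis .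
qed

text \<open>Earlier terms of the martingale agree on both children and cancel against the sign of
  \<open>rademacher n\<close>; the new term lives only on the interval around 0.\<close>

lemma fourier_coeff_lacunary: "fourier_coeff (lacunary p) (2 ^ n) = 2 powr (n / (2 * p))"
proof -
  let ?c = "2 powr (n / (2 * p))"
  have k: "kaczmarz (2 ^ n) t = rademacher n t" for t
    using kaczmarz_add[of 0 n t] by (simp add: revwalsh_def)
  have "fourier_coeff (lacunary p) (2 ^ n)
      = (\<Sum>t\<in>cube (Suc n). lacunary p (Suc n) t * rademacher n t) / 2 ^ Suc n"
    using fourier_coeff_eq[OF walsh_martingale_lacunary, of "2 ^ n" "Suc n" p] by (simp add: k)
  also have "(\<Sum>t\<in>cube (Suc n). lacunary p (Suc n) t * rademacher n t)
      = (\<Sum>t\<in>cube n. lacunary p (Suc n) t * rademacher n t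
          + lacunary p (Suc n) (t(n := True)) * rademacher n (t(n := True)))"
    by (rule sum_cube_Suc)
  also have "\<dots> = (\<Sum>t\<in>cube n. if t = (\<lambda>_. False) then 2 * ?c * 2 ^ n else 0)"
  proof (rule sum.cong[OF refl])
    fix t assume t: "t \<in> cube n"
    have l: "lacunary p (Suc n) s = lacunary p n s + ?c * 2 ^ n * (if \<forall>j<n. \<not> s j then rademacher n s else 0)" for s
      by (simp add: lacunary_def)
    have m: "lacunary p n (t(n := True)) = lacunary p n t"
      by (rule depends_below_upd[OF martingale_depends[OF walsh_martingale_lacunary]]) simp
    have z: "(\<forall>j<n. \<not> t j) \<longleftrightarrow> t = (\<lambda>_. False)"
      using t by (auto simp: cube_def fun_eq_iff) (metis not_le)
    have tn: "\<not> t n" using t by (simp add: cube_def)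
    have z': "(\<forall>j<n. \<not> (t(n := True)) j) \<longleftrightarrow> (\<forall>j<n. \<not> t j)" by auto
    show "lacunary p (Suc n) t * rademacher n t
        + lacunary p (Suc n) (t(n := True)) * rademacher n (t(n := True))
        = (if t = (\<lambda>_. False) then 2 * ?c * 2 ^ n else 0)"
      unfolding l m z' z using tn by (simp add: rademacher_def)
  qed
  also have "\<dots> = 2 * ?c * 2 ^ n"
  proof -
    have "(\<lambda>_. False) \<in> cube n" by (simp add: cube_def)
    then show ?thesis by (simp add: sum.delta)
  qed
  finally show ?thesis by simp
qed

lemma T_mean_unbounded:
  fixes q :: "nat \<Rightarrow> real"
  assumes q: "mono q" "\<And>k. q k \<ge> 0" "q 0 > 0" and p: "0 < p" "p < 1/2"
  shows "(SUP n\<in>{1..}. weak_pow p (\<lambda>x. ennreal \<bar>T_mean q n (lacunary p) x\<bar>)) = \<infinity>"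
    (is "?S = _")
proof -
  let ?T = "\<lambda>n x. T_mean q n (lacunary p) x" and ?P = "\<lambda>k x. partial_sum k (lacunary p) x"
  note qp = q_pos[OF q] and Qp = Qsum_pos[OF q] and Ql = Qsum_le[OF q]
  \<comment> \<open>Monotonicity enters through \<open>Qsum q (Suc k) \<le> Suc k * q k\<close>,
    which lets \<open>q k\<close> cancel from the increment identity.\<close>
  have PT: "\<bar>?P k x\<bar> \<le> real (Suc k) * (\<bar>?T (Suc k) x\<bar> + \<bar>?T k x\<bar>)" if k: "1 \<le> k" for k x
  proof -
    have U: "Qsum q n * ?T n x = (\<Sum>k<n. q k * ?P k x)" if "1 \<le> n" for n
      using Qp[OF that] by (simp add: T_mean_def)
    have eq: "q k * ?P k x = Qsum q (Suc k) * ?T (Suc k) x - Qsum q k * ?T k x"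
      using U[of k] U[of "Suc k"] k by simp
    have "q k * \<bar>?P k x\<bar> = \<bar>q k * ?P k x\<bar>" using qp[of k] by (simp add: abs_mult)
    also have "\<dots> \<le> \<bar>Qsum q (Suc k) * ?T (Suc k) x\<bar> + \<bar>Qsum q k * ?T k x\<bar>"
      unfolding eq by (rule abs_triangle_ineq4)
    also have "\<dots> = Qsum q (Suc k) * \<bar>?T (Suc k) x\<bar> + Qsum q k * \<bar>?T k x\<bar>"
      using Qp[OF k] Qp[of "Suc k"] by (simp add: abs_mult)
    also have "\<dots> \<le> (real (Suc k) * q k) * \<bar>?T (Suc k) x\<bar> + (real (Suc k) * q k) * \<bar>?T k x\<bar>"
      using Ql[of "Suc k" k] Ql[of k k] qp[of k] by (intro add_mono mult_right_mono) (auto simp: algebra_simps)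
    also have "\<dots> = q k * (real (Suc k) * (\<bar>?T (Suc k) x\<bar> + \<bar>?T k x\<bar>))" by (simp add: algebra_simps)
    finally show ?thesis using qp[of k] by simp
  qed
  have lower: "ennreal ((2 powr (real n * (1 / (2 * p) - 1)) / 24) powr p / 3) \<le> ?S" for n :: nat
  proof -
    let ?N = "2 ^ n :: nat" and ?c = "2 powr (real n / (2 * p))"
    \<comment> \<open>If all three means were at most \<tau>, the two partial sums together would be
      at most \<open>4 * (2 ^ n + 2) * \<tau>\<close>, half the jump \<open>?c\<close>.\<close>
    define \<tau> where "\<tau> = ?c / (8 * real (?N + 2))"
    have \<tau>: "\<tau> > 0" unfolding \<tau>_def
      by (intro divide_pos_pos mult_pos_pos) (simp_all add: add_pos_pos)
    define A where "A j = {x. \<bar>?T j x\<bar> > \<tau>}" for j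
    have A: "A j \<in> sets walsh_measure" for j
    proof -
      have "depends_below j (\<lambda>x. \<bar>?T j x\<bar> > \<tau>)"
        using depends_T_mean[of j j q "lacunary p"] less_exp[of j]
        unfolding depends_below_def by (metis less_imp_le)
      then show ?thesis unfolding A_def by (rule emeasure_depends_below(1))
    qed
    have "x \<in> A ?N \<union> A (?N + 1) \<union> A (?N + 2)" for x
    proof (rule ccontr)
      assume "\<not> ?thesis"
      then have T: "\<bar>?T ?N x\<bar> \<le> \<tau>" "\<bar>?T (Suc ?N) x\<bar> \<le> \<tau>" "\<bar>?T (Suc (Suc ?N)) x\<bar> \<le> \<tau>"
        by (auto simp: A_def)
      have "?P (Suc ?N) x - ?P ?N x = ?c * kaczmarz ?N x"
        by (simp add: partial_sum_def fourier_coeff_lacunary)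
      moreover have "\<bar>kaczmarz ?N x\<bar> = 1"
        using kaczmarz_add[of 0 n x] by (simp add: revwalsh_def rademacher_def)
      ultimately have "?c \<le> \<bar>?P (Suc ?N) x\<bar> + \<bar>?P ?N x\<bar>"
        using abs_triangle_ineq4[of "?P (Suc ?N) x" "?P ?N x"] by (simp add: abs_mult)
      also have "\<dots> \<le> real (Suc (Suc ?N)) * (\<tau> + \<tau>) + real (Suc ?N) * (\<tau> + \<tau>)"
        using T by (intro add_mono order_trans[OF PT] mult_left_mono) auto
      also have "\<dots> \<le> real (?N + 2) * (\<tau> + \<tau>) + real (?N + 2) * (\<tau> + \<tau>)"
        using \<tau> by (intro add_mono mult_right_mono) auto
      also have "\<dots> = ?c / 2"
      proof -
        have "R * (c / (8 * R) + c / (8 * R)) + R * (c / (8 * R) + c / (8 * R)) = c / 2"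
          if "R > 0" for R c :: real
          using that by (simp add: field_simps)
        moreover have "real (?N + 2) > 0" by (subst of_nat_0_less_iff) simp
        ultimately show ?thesis unfolding \<tau>_def by blast
      qed
      finally show False by simp
    qed
    then have un: "space walsh_measure = A ?N \<union> A (?N + 1) \<union> A (?N + 2)" by auto
    interpret prob_space walsh_measure by (rule prob_space_walsh)
    have "1 \<le> prob (A ?N) + prob (A (?N + 1)) + prob (A (?N + 2))"
      using prob_space un A measure_Un_le[of "A ?N \<union> A (?N + 1)" walsh_measure "A (?N + 2)"]
        measure_Un_le[of "A ?N" walsh_measure "A (?N + 1)"] by (simp del: space_walsh)
    then obtain j where j: "j \<ge> 1" "prob (A j) \<ge> 1/3"
    proof -
      assume t: "\<And>j. 1 \<le> j \<Longrightarrow> 1/3 \<le> prob (A j) \<Longrightarrow> thesis"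
      assume "1 \<le> prob (A ?N) + prob (A (?N + 1)) + prob (A (?N + 2))"
      then have "prob (A ?N) \<ge> 1/3 \<or> prob (A (?N + 1)) \<ge> 1/3 \<or> prob (A (?N + 2)) \<ge> 1/3" by linarith
      then show thesis using t[of ?N] t[of "?N + 1"] t[of "?N + 2"] by auto
    qed
    have "(2 powr (real n * (1 / (2 * p) - 1)) / 24) \<le> \<tau>"
    proof -
      \<comment> \<open>24 = 8 * 3, from \<open>2 ^ n + 2 \<le> 3 * 2 ^ n\<close>.\<close>
      have "2 powr (real n * (1 / (2 * p) - 1)) = ?c / 2 ^ n"
        by (simp add: right_diff_distrib powr_diff powr_realpow)
      also have "\<dots> / 24 = ?c / (8 * (3 * 2 ^ n))" by simp
      also have "\<dots> \<le> \<tau>" unfolding \<tau>_def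
        by (intro divide_left_mono) (auto intro!: mult_pos_pos add_pos_pos simp: one_le_power)
      finally show ?thesis .
    qed
    then have "(2 powr (real n * (1 / (2 * p) - 1)) / 24) powr p \<le> \<tau> powr p"
      using p by (intro powr_mono2) auto
    then have "(2 powr (real n * (1 / (2 * p) - 1)) / 24) powr p / 3 \<le> \<tau> powr p * prob (A j)"
      using j(2) mult_mono[of _ "\<tau> powr p" "1/3" "prob (A j)"] by simp
    then have "ennreal ((2 powr (real n * (1 / (2 * p) - 1)) / 24) powr p / 3)
        \<le> ennreal (\<tau> powr p * prob (A j))" by (rule ennreal_leI)
    also have "\<dots> = ennreal (\<tau> powr p) * emeasure walsh_measure (A j)"
      by (simp add: emeasure_eq_measure ennreal_mult)
    also have "A j = {x \<in> space walsh_measure. ennreal \<bar>?T j x\<bar> > ennreal \<tau>}"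
      using \<tau> by (auto simp: A_def ennreal_less_iff)
    also have "ennreal (\<tau> powr p) * emeasure walsh_measure \<dots> \<le> weak_pow p (\<lambda>x. ennreal \<bar>?T j x\<bar>)"
      unfolding weak_pow_def using \<tau> by (intro SUP_upper2[of \<tau>]) auto
    also have "\<dots> \<le> ?S" using j(1) by (intro SUP_upper) auto
    finally show ?thesis .
  qed
  show ?thesis
  proof (rule ccontr)
    assume "?S \<noteq> \<infinity>"
    then obtain r where r: "?S = ennreal r" "r \<ge> 0" by (cases ?S) auto
    \<comment> \<open>The exponent equals \<open>1/2 - p\<close>, so the lower bounds grow
      geometrically in \<open>n\<close>.\<close>
    let ?b = "2 powr ((1 / (2 * p) - 1) * p) :: real"
    have "(1 / (2 * p) - 1) * p > 0" using p by (simp add: field_simps)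
    then have "?b > 1" by simp
    then obtain n where n: "3 * 24 powr p * r < ?b ^ n" using real_arch_pow by blast
    have "(2 powr (real n * (1 / (2 * p) - 1)) / 24) powr p = ?b ^ n / 24 powr p"
    proof -
      have "?b ^ n = 2 powr (real n * (1 / (2 * p) - 1) * p)"
        by (subst powr_realpow[symmetric]) (simp_all add: powr_powr mult_ac)
      then show ?thesis by (simp add: powr_divide powr_powr)
    qed
    moreover have "(2 powr (real n * (1 / (2 * p) - 1)) / 24) powr p / 3 \<le> r"
      using lower[of n] r by (simp add: ennreal_le_iff)
    ultimately have "?b ^ n / 24 powr p / 3 \<le> r" by (simp only:)
    moreover have "B \<le> 3 * d * r" if "B / d / 3 \<le> r" "d > 0" for B d :: real
      using that by (simp add: field_simps)
    ultimately have "?b ^ n \<le> 3 * 24 powr p * r" by simp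
    then show False using n by simp
  qed
qed

theorem theorem2:
  fixes q :: "nat \<Rightarrow> real"
  assumes mono_q: "mono q"
    and nonneg: "\<And>k. q k \<ge> 0"
    and q0: "q 0 > 0"
  shows "((\<lambda>n. q (n - 1) / Qsum q n) \<in> O(\<lambda>n. 1 / real n) \<longrightarrow>
           (\<exists>C::real. \<forall>f. walsh_martingale f \<and> hardy_pow (1/2) f < \<infinity> \<longrightarrow>
               weak_pow (1/2) (T_max q f) \<le> ennreal C * hardy_pow (1/2) f))
       \<and> (\<forall>p::real. 0 < p \<and> p < 1/2 \<longrightarrow>
           (\<exists>f. walsh_martingale f \<and> hardy_pow p f < \<infinity> \<and>
               (SUP n\<in>{1..}. weak_pow p (\<lambda>x. ennreal \<bar>T_mean q n f x\<bar>)) = \<infinity>))"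
  using T_max_weak_bound[OF assms] walsh_martingale_lacunary hardy_pow_lacunary
    T_mean_unbounded[OF assms] by blast

end
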